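(* There exists a $\beta_r=\beta(r)>0$ such that for all $n\ge r\ge 4$ $$n^2 e^{-\beta_r\sqrt{\log n}} < U_r(n,r)\le \frac{n(n-1)}{r(r-1)}.$$ In addition, if $r$ divides $n$, then the lower bound is attained by an $n$-vertex, $r$-uniform, $r$-union-free family (with more than $n^2 e^{-\beta_r\sqrt{\log n}}$ members) that can be decomposed into perfect matchings; in particular it is regular.
   Context: A family $\mathcal F$ of subsets of $[n]=\{1,\dots,n\}$ is $e$-union-free if for any two distinct subfamilies $\mathcal A,\mathcal B\subseteq\mathcal F$ with $0<|\mathcal A|,|\mathcal B|\le e$ one has $\bigcup_{A\in\mathcal A}A\ne\bigcup_{B\in\mathcal B}B$. $U_r(n,e)$ is the maximum size of an $e$-union-free family of $r$-element subsets of $[n]$. A perfect matching is a subfamily whose members cover every vertex exactly once; a hypergraph is regular if all vertices lie in the same number of edges.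
   Formalization: The upper bound U_r(n,r) ≤ n(n-1)/(r(r-1)) is stated only for n = r or n ≥ (r-1)^2; for r < n < (r-1)^2 it is false, since the n-r+1 r-sets through r-1 fixed points are r-union-free (e.g. U_4(5,4) ≥ 2 > 20/12). *)

theory Defs
  imports Complex_Main "HOL-Library.Disjoint_Sets"
begin

definition union_free :: "nat \<Rightarrow> 'a set set \<Rightarrow> bool" where
  "union_free e F \<longleftrightarrow>
     (\<forall>A B. A \<subseteq> F \<and> B \<subseteq> F \<and> A \<noteq> B \<and>
        0 < card A \<and> card A \<le> e \<and> 0 < card B \<and> card B \<le> e \<longrightarrow> \<Union>A \<noteq> \<Union>B)"

definition uniform :: "nat \<Rightarrow> 'a set \<Rightarrow> 'a set set \<Rightarrow> bool" where
  "uniform r V F \<longleftrightarrow> (\<forall>A\<in>F. A \<subseteq> V \<and> card A = r)"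

definition U :: "nat \<Rightarrow> nat \<Rightarrow> nat \<Rightarrow> nat" where
  "U r n e = Max (card ` {F. uniform r {1..n} F \<and> union_free e F})"

definition perfect_matching :: "'a set \<Rightarrow> 'a set set \<Rightarrow> 'a set set \<Rightarrow> bool" where
  "perfect_matching V F M \<longleftrightarrow> M \<subseteq> F \<and> (\<forall>v\<in>V. \<exists>!A. A \<in> M \<and> v \<in> A)"

definition decomposes_into_perfect_matchings :: "'a set \<Rightarrow> 'a set set \<Rightarrow> bool" where
  "decomposes_into_perfect_matchings V F \<longleftrightarrow>
     (\<exists>P. partition_on F P \<and> (\<forall>M\<in>P. perfect_matching V F M))"

definition regular :: "'a set \<Rightarrow> 'a set set \<Rightarrow> bool" where
  "regular V F \<longleftrightarrow> (\<exists>d. \<forall>v\<in>V. card {A \<in> F. v \<in> A} = d)"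

lemma finite_uniform_union_free: "finite {F. uniform r {1..n::nat} F \<and> union_free e F}"
  by (rule finite_subset[of _ "Pow (Pow {1..n})"]) (auto simp: uniform_def)

lemma card_le_U:
  assumes "uniform r {1..n} F" "union_free e F"
  shows "card F \<le> U r n e"
  unfolding U_def using assms finite_uniform_union_free by (intro Max_ge) auto

text \<open>
  The bound \<open>U r n r \<le> n (n - 1) / (r (r - 1))\<close> fails for every \<open>n\<close> strictly between \<open>r\<close> and
  \<open>(r - 1)\<^sup>2\<close>: all \<open>r\<close>-sets through \<open>r - 1\<close> common points form an \<open>r\<close>-union-free family with
  \<open>n - r + 1\<close> members. For example, \<open>{1,2,3,4}\<close> and \<open>{1,2,3,5}\<close> give \<open>U 4 5 4 \<ge> 2 > 20 / 12\<close>.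
  So the upper bound is only claimed for \<open>n = r\<close> and for \<open>n \<ge> (r - 1)\<^sup>2\<close>.
\<close>

lemma sunflower_le_U:
  assumes "1 \<le> r" "r \<le> n"
  shows "n - r + 1 \<le> U r n e"
proof -
  let ?C = "{1..<r}" and ?F = "(\<lambda>x. insert x {1..<r}) ` {r..n}"
  have inj: "inj_on (\<lambda>x. insert x ?C) {r..n}"
    by (auto simp: inj_on_def)
  have "uniform r {1..n} ?F"
    using assms by (auto simp: uniform_def)
  moreover have "union_free e ?F"
    unfolding union_free_def
  proof (intro allI impI notI, elim conjE)
    fix A B assume sub: "A \<subseteq> ?F" "B \<subseteq> ?F" and ne: "A \<noteq> B" and eq: "\<Union>A = \<Union>B"
    have *: "insert x ?C \<in> D \<longleftrightarrow> x \<in> \<Union>D" if "D \<subseteq> ?F" "x \<in> {r..n}" for D x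
    proof
      assume "x \<in> \<Union>D"
      then obtain X where X: "X \<in> D" "x \<in> X" by blast
      with that obtain y where "X = insert y ?C" by auto
      with X that show "insert x ?C \<in> D" by auto
    qed blast
    have "X \<in> A \<longleftrightarrow> X \<in> B" if "X \<in> ?F" for X
      using that *[OF sub(1)] *[OF sub(2)] eq by auto
    with sub have "A = B" by blast
    with ne show False by blast
  qed
  ultimately have "card ?F \<le> U r n e" by (rule card_le_U)
  then show ?thesis using card_image[OF inj] assms by simp
qed

lemma upper_bound_fails:
  assumes "r < n" "n < (r - 1)\<^sup>2"
  shows "real n * (real n - 1) / (real r * (real r - 1)) < real (U r n e)"
proof -
  have r: "2 \<le> r" using assms by (cases r; cases "r - 1") auto
  have "real n < real ((r - 1)\<^sup>2)" using assms by linarith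
  then have "real n < (real r - 1)\<^sup>2" using r by (simp add: of_nat_diff)
  then have "0 < (real n - real r) * ((real r - 1)\<^sup>2 - real n)" using assms by simp
  then have "real n * (real n - 1) < (real n - real r + 1) * (real r * (real r - 1))"
    by (simp add: algebra_simps power2_eq_square)
  moreover have "0 < real r * (real r - 1)" using r by simp
  ultimately have "real n * (real n - 1) / (real r * (real r - 1)) < real n - real r + 1"
    by (simp add: pos_divide_less_eq)
  moreover have "real n - real r + 1 \<le> real (U r n e)"
    using sunflower_le_U[of r n e] r assms by linarith
  ultimately show ?thesis by linarith
qed

end

theory Submission
  imports Defs "HOL-Library.FuncSet" "HOL-Number_Theory.Cong"
begin

text \<open>
  Upper bound. In an \<open>r\<close>-union-free family no edge is covered by fewer than \<open>r\<close> others, since adding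
  a covered edge to its cover would not change the union. If an \<open>r\<close>-edge \<open>A\<close> meets another edge in
  two points, then \<open>A\<close> must have a vertex of degree one: otherwise that edge and one further edge for
  each of the at most \<open>r - 2\<close> other vertices would cover \<open>A\<close>. After removing one private vertex for every edge
  that has one, the remaining edges form a linear family on the remaining vertices, and counting
  pairs bounds them (\<open>union_free_card_bound\<close>).

  Lower bound. Let \<open>m = n div r\<close>. The vertices are \<open>r\<close> copies of the residues modulo \<open>m\<close>, and the
  edges are the ``lines'' \<open>k \<mapsto> x + c\<^sub>k a\<close> with an arbitrary start \<open>x\<close> and a slope \<open>a\<close> in a set \<open>S\<close>. The
  \<open>m\<close> lines of a fixed slope form a perfect matching, so the family decomposes into \<open>card S\<close> of them.
  If \<open>S\<close> lies in a short initial segment, equations between slopes modulo \<open>m\<close> hold over the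
  integers; in particular two lines share at most one vertex. A linear family is \<open>r\<close>-union-free as
  soon as it contains neither a triangle nor an \<open>r \<times> r\<close> grid
  (\<open>union_free_if_no_triangle_no_grid\<close>).

  \<^item> A triangle yields \<open>\<alpha> a\<^sub>1 + \<beta> a\<^sub>2 + \<gamma> a\<^sub>3 = 0\<close> with bounded nonzero coefficients of sum zero. Behrend's
    sets, digit vectors on a sphere, have no such relation between different elements and still have
    size \<open>m exp (- O(sqrt (ln m)))\<close> (\<open>behrend\<close>).
  \<^item> In a grid with lines \<open>(X\<^sub>i, a\<^sub>i)\<close> and \<open>(Y\<^sub>j, b\<^sub>j)\<close>, the index \<open>L i j\<close> of the copy containing the common
    vertex is a Latin square, and \<open>X\<^sub>i + c a\<^sub>i = Y\<^sub>j + c b\<^sub>j\<close> for \<open>c = c\<^bsub>L i j\<^esub>\<close>. The coefficients are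
    chosen such that this system forces all slopes to be equal whatever the Latin square is
    (\<open>grid_solution_trivial\<close>): \<open>r div 2\<close> of them are divisible by a prime \<open>p\<close>, and the solutions are shown
    to be trivial modulo \<open>p\<close>, which allows an infinite descent. This is where \<open>r \<ge> 4\<close> enters: a
    symbol class of size \<open>r div 2 \<ge> 2\<close> can only split the rows into two blocks, each of
    which has at least two rows. Two intersecting lines of equal slope coincide, so no grid exists.
\<close>

section \<open>The upper bound\<close>

text \<open>
  Adding \<open>A\<close> to a cover \<open>G\<close> of \<open>A\<close> yields a different family with the same union.
\<close>

lemma union_free_not_covered:
  assumes F: "union_free r F" and A: "A \<in> F"
    and G: "G \<subseteq> F - {A}" "finite G" "G \<noteq> {}" "card G < r"
  shows "\<not> A \<subseteq> \<Union>G"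
proof
  assume "A \<subseteq> \<Union>G"
  then have "\<Union>(insert A G) = \<Union>G" by blast
  moreover have "card (insert A G) = Suc (card G)" using G by (subst card_insert_disjoint) auto
  moreover have "0 < card G" using G by (simp add: card_gt_0_iff)
  moreover have "insert A G \<subseteq> F" "G \<subseteq> F" "insert A G \<noteq> G" using A G by auto
  ultimately show False
    using F G unfolding union_free_def by (metis Suc_leI less_imp_le zero_less_Suc)
qed

text \<open>
  If every vertex of \<open>A\<close> lay in a further edge, then \<open>B\<close> together with one further edge through
  each of the at most \<open>r - 2\<close> vertices of \<open>A - B\<close> would cover \<open>A\<close> with fewer than \<open>r\<close> edges.
\<close>

lemma private_vertex_if_double_intersection:
  assumes F: "union_free r F" and A: "A \<in> F" "finite A" "card A = r" and B: "B \<in> F" "A \<noteq> B"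
    and AB: "2 \<le> card (A \<inter> B)"
  shows "\<exists>v\<in>A. \<forall>C\<in>F. v \<in> C \<longrightarrow> C = A"
proof (rule ccontr)
  assume "\<not> ?thesis"
  then have "\<forall>v\<in>A. \<exists>C. C \<in> F - {A} \<and> v \<in> C" by blast
  then obtain C where C: "\<And>v. v \<in> A \<Longrightarrow> C v \<in> F - {A} \<and> v \<in> C v" by metis
  define G where "G = insert B (C ` (A - B))"
  have fin: "finite (A - B)" using A by simp
  have "card (A - B) = r - card (A \<inter> B)" using A by (simp add: card_Diff_subset_Int)
  moreover have "card (A \<inter> B) \<le> r" using A by (metis card_mono inf_le1)
  ultimately have "card (A - B) + 2 \<le> r" using AB by linarith
  moreover have "card G \<le> Suc (card (A - B))"
    using fin card_image_le[OF fin, of C] by (simp add: G_def card_insert_if)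
  ultimately have "card G < r" by linarith
  moreover have "G \<subseteq> F - {A}" "finite G" "G \<noteq> {}" using B C fin by (auto simp: G_def)
  ultimately have "\<not> A \<subseteq> \<Union>G" using union_free_not_covered[OF F A(1)] by blast
  moreover have "A \<subseteq> \<Union>G" using C by (auto simp: G_def)
  ultimately show False by blast
qed

lemma card_ordered_pairs:
  assumes "finite A"
  shows "card {(x, y). x \<in> A \<and> y \<in> A \<and> x \<noteq> y} = card A * (card A - 1)"
proof -
  have "{(x, y). x \<in> A \<and> y \<in> A \<and> x \<noteq> y} = (SIGMA x:A. A - {x})" by auto
  then show ?thesis using assms by simp
qed

text \<open>
  The ordered pairs inside different edges are different pairs of \<open>W\<close>.
\<close>

lemma linear_family_card_bound:
  assumes W: "finite W" and F: "uniform r W F" and lin: "\<And>A B. A \<in> F \<Longrightarrow> B \<in> F \<Longrightarrow> A \<noteq> B \<Longrightarrow> card (A \<inter> B) \<le> 1"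
  shows "card F * (r * (r - 1)) \<le> card W * (card W - 1)"
proof -
  define pairs where "pairs A = {(x, y). x \<in> A \<and> y \<in> A \<and> x \<noteq> y}" for A :: "'a set"
  have sub: "A \<subseteq> W" "finite A" "card A = r" if "A \<in> F" for A
    using F W that by (auto simp: uniform_def intro: finite_subset)
  have finF: "finite F" using sub(1) W by (intro finite_subset[of F "Pow W"]) auto
  have fin: "finite (pairs A)" if "finite A" for A
    using that by (intro finite_subset[of "pairs A" "A \<times> A"]) (auto simp: pairs_def)
  have disj: "pairs A \<inter> pairs B = {}" if "A \<in> F" "B \<in> F" "A \<noteq> B" for A B
  proof (rule ccontr)
    assume "pairs A \<inter> pairs B \<noteq> {}"
    then obtain x y where xy: "{x, y} \<subseteq> A \<inter> B" "x \<noteq> y" by (auto simp: pairs_def)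
    then have "card {x, y} \<le> card (A \<inter> B)" using sub(2)[OF that(1)] by (intro card_mono) auto
    then show False using lin[OF that] xy by simp
  qed
  have "card F * (r * (r - 1)) = (\<Sum>A\<in>F. card (pairs A))"
    using sub by (simp add: pairs_def card_ordered_pairs)
  also have "\<dots> = card (\<Union>A\<in>F. pairs A)"
    using finF fin sub disj by (intro card_UN_disjoint[symmetric]) auto
  also have "\<dots> \<le> card (pairs W)"
    using sub W fin by (intro card_mono) (auto simp: pairs_def)
  also have "\<dots> = card W * (card W - 1)" using W by (simp add: pairs_def card_ordered_pairs)
  finally show ?thesis .
qed

text \<open>
  Let \<open>m\<close> edges have private vertices and let \<open>k\<close> vertices remain after removing one private vertex
  of each. The bound \<open>m + k (k - 1) / (r (r - 1))\<close> is convex in \<open>m\<close> and is compared with the case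
  \<open>m = 0\<close>. The extreme case without other edges has \<open>m = n - r + 1\<close>, where the comparison is
  \<open>(n - r) (n - (r - 1)\<^sup>2) \<ge> 0\<close>; this explains the condition on \<open>n\<close>.
\<close>

lemma union_free_card_bound:
  fixes V :: "'a set"
  assumes r: "3 \<le> r" and V: "finite V" "card V = n" and n: "n = r \<or> (r - 1)\<^sup>2 \<le> n"
    and F: "uniform r V F" "union_free r F"
  shows "card F * (r * (r - 1)) \<le> n * (n - 1)"
proof -
  have sub: "A \<subseteq> V" "finite A" "card A = r" if "A \<in> F" for A
    using F V that by (auto simp: uniform_def intro: finite_subset)
  have finF: "finite F" using sub(1) V by (intro finite_subset[of F "Pow V"]) auto
  define F1 where "F1 = {A \<in> F. \<exists>v\<in>A. \<forall>C\<in>F. v \<in> C \<longrightarrow> C = A}"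
  define F0 where "F0 = F - F1"
  have "\<forall>A\<in>F1. \<exists>v. v \<in> A \<and> (\<forall>C\<in>F. v \<in> C \<longrightarrow> C = A)" by (auto simp: F1_def)
  from bchoice[OF this] obtain own where
    own: "\<And>A. A \<in> F1 \<Longrightarrow> own A \<in> A" "\<And>A C. A \<in> F1 \<Longrightarrow> C \<in> F \<Longrightarrow> own A \<in> C \<Longrightarrow> C = A"
    by blast
  have F10: "F1 \<subseteq> F" "F0 \<subseteq> F" "F0 \<inter> F1 = {}" "F = F0 \<union> F1" by (auto simp: F0_def F1_def)
  then have finF1: "finite F1" and finF0: "finite F0" using finF by (auto intro: finite_subset)
  define W where "W = V - own ` F1"
  have "inj_on own F1"
  proof (rule inj_onI)
    fix A B assume "A \<in> F1" "B \<in> F1" "own A = own B"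
    then show "A = B" using own(1)[of B] own(2)[of A B] F10(1) by auto
  qed
  then have im: "card (own ` F1) = card F1" by (rule card_image)
  have ownV: "own ` F1 \<subseteq> V" using own sub(1) F10 by blast
  then have nW: "n = card F1 + card W"
    using V im card_Diff_subset[of "own ` F1" V] card_mono[OF V(1) ownV] finF1 by (simp add: W_def)
  have tot: "card F = card F0 + card F1"
    using finF0 finF1 F10 card_Un_disjoint by metis
  have F0W: "A \<subseteq> W" if "A \<in> F0" for A
    using that own(2)[of _ A] sub(1)[of A] F10 unfolding W_def by blast
  then have u0: "uniform r W F0" using sub F10 by (auto simp: uniform_def)
  have finW: "finite W" using V by (simp add: W_def)
  have "card (A \<inter> B) \<le> 1" if AB: "A \<in> F0" "B \<in> F0" "A \<noteq> B" for A B
  proof (rule ccontr)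
    assume "\<not> card (A \<inter> B) \<le> 1"
    then have "2 \<le> card (A \<inter> B)" by simp
    moreover have A: "A \<in> F" "A \<notin> F1" "B \<in> F" using AB F10 by auto
    ultimately have "\<exists>v\<in>A. \<forall>C\<in>F. v \<in> C \<longrightarrow> C = A"
      using private_vertex_if_double_intersection[OF F(2) A(1) sub(2,3)[OF A(1)] A(3) AB(3)] by blast
    with A show False by (simp add: F1_def)
  qed
  then have lin: "card F0 * (r * (r - 1)) \<le> card W * (card W - 1)"
    by (intro linear_family_card_bound[OF finW u0])
  have k0: "r \<le> card W" if ne: "F0 \<noteq> {}"
  proof -
    obtain A where A: "A \<in> F0" using ne by blast
    have "card A \<le> card W" using F0W[OF A] finW by (rule card_mono[rotated])
    then show ?thesis using sub A F10 by auto
  qed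
  have k1: "r \<le> card W + 1" if ne: "F1 \<noteq> {}"
  proof -
    obtain A where A: "A \<in> F1" using ne by blast
    have AF: "A \<in> F" using A F10 by blast
    have "A - {own A} \<subseteq> W" using own(2)[OF _ AF] sub(1)[OF AF] unfolding W_def by blast
    then have "card (A - {own A}) \<le> card W" using finW by (rule card_mono[rotated])
    then show ?thesis using sub[OF AF] own(1)[OF A] by simp
  qed
  define m k x where "m = int (card F1)" and "k = int (card W)" and "x = int r"
  have nn: "int n = m + k" using nW by (simp add: m_def k_def)
  have x3: "3 \<le> x" using r by (simp add: x_def)
  have n': "m + k = x \<or> (x - 1)\<^sup>2 \<le> m + k"
  proof (rule disj_forward[OF n])
    assume "(r - 1)\<^sup>2 \<le> n"
    then have "int ((r - 1)\<^sup>2) \<le> int n" by simp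
    then show "(x - 1)\<^sup>2 \<le> m + k" using r nn by (simp add: x_def of_nat_diff)
  qed (use nn in \<open>simp add: x_def\<close>)
  have m0: "0 \<le> m" "0 \<le> k" by (auto simp: m_def k_def)
  have lin': "int (card F0) * (x * (x - 1)) \<le> k * (k - 1)"
  proof (cases "F0 = {}")
    case True
    then show ?thesis using m0 by (cases "k = 0") auto
  next
    case False
    then have "1 \<le> card W" using k0 r by simp
    moreover have "int (card F0 * (r * (r - 1))) \<le> int (card W * (card W - 1))"
      using lin by (simp only: of_nat_le_iff)
    ultimately show ?thesis using r by (simp add: x_def k_def of_nat_diff)
  qed
  have "(int (card F0) + m) * (x * (x - 1)) \<le> (m + k) * (m + k - 1)"
  proof (cases "F1 = {}")
    case True
    then show ?thesis using lin' by (simp add: m_def)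
  next
    case m1: False
    then have mp: "1 \<le> m" using finF1 by (simp add: m_def Suc_leI card_gt_0_iff)
    show ?thesis
    proof (cases "F0 = {}")
      case True
      have "x \<le> k + 1" using k1[OF m1] by (simp add: x_def k_def)
      then have "m \<le> m + k - x + 1" by simp
      then have "m * (x * (x - 1)) \<le> (m + k - x + 1) * (x * (x - 1))" using x3 by (intro mult_right_mono) auto
      also have "\<dots> = (m + k) * (m + k - 1) - (m + k - x) * (m + k - (x - 1)\<^sup>2)"
        by (simp add: power2_eq_square algebra_simps)
      finally have "m * (x * (x - 1)) \<le> (m + k) * (m + k - 1) - (m + k - x) * (m + k - (x - 1)\<^sup>2)" .
      moreover have "0 \<le> (m + k - x) * (m + k - (x - 1)\<^sup>2)"
      proof (cases "m + k = x")
        case False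
        then have *: "(x - 1)\<^sup>2 \<le> m + k" using n' by simp
        have "x * 3 \<le> x * x" using x3 by (intro mult_left_mono) auto
        moreover have "(x - 1)\<^sup>2 = x * x - 2 * x + 1" by (simp add: power2_eq_square algebra_simps)
        ultimately have "x \<le> (x - 1)\<^sup>2" by linarith
        then show ?thesis using * by (intro mult_nonneg_nonneg) auto
      qed simp
      ultimately have "m * (x * (x - 1)) \<le> (m + k) * (m + k - 1)" by linarith
      then show ?thesis using True by simp
    next
      case False
      have kx: "x \<le> k" using k0[OF False] by (simp add: x_def k_def)
      then have "(x - 1)\<^sup>2 \<le> m + k" using n' mp by auto
      then have "x * (x - 1) \<le> m + 2 * k - 1" using kx by (simp add: power2_eq_square algebra_simps)
      then have "m * (x * (x - 1)) \<le> m * (m + 2 * k - 1)" using m0 by (intro mult_left_mono)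
      then show ?thesis using lin' by (simp add: algebra_simps)
    qed
  qed
  then have "int (card F * (r * (r - 1))) \<le> int n * (int n - 1)"
    using r tot nn by (simp add: m_def x_def of_nat_diff)
  also have "\<dots> = int (n * (n - 1))"
    by (cases n) (auto simp: algebra_simps)
  finally show ?thesis by (simp only: of_nat_le_iff)
qed

section \<open>A sufficient condition for being union-free\<close>

text \<open>
  The \<open>r\<close> points of \<open>X\<close> need \<open>r\<close> different members of the cover, so choosing a member for each point is
  a bijection.
\<close>

lemma cover_by_small_intersections:
  assumes X: "finite X" "card X = r" "X \<subseteq> \<Union>\<B>" and B: "finite \<B>" "card \<B> \<le> r"
    and small: "\<And>Y. Y \<in> \<B> \<Longrightarrow> card (X \<inter> Y) \<le> 1"
  shows "card \<B> = r" and "Y \<in> \<B> \<Longrightarrow> X \<inter> Y \<noteq> {}"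
    and "Y \<in> \<B> \<Longrightarrow> Y' \<in> \<B> \<Longrightarrow> Y \<noteq> Y' \<Longrightarrow> X \<inter> Y \<inter> Y' = {}"
proof -
  have "\<forall>v\<in>X. \<exists>Y. Y \<in> \<B> \<and> v \<in> Y" using X(3) by blast
  from bchoice[OF this] obtain f where f: "\<And>v. v \<in> X \<Longrightarrow> f v \<in> \<B> \<and> v \<in> f v" by blast
  have one: "v = w" if "v \<in> X" "w \<in> X" "Y \<in> \<B>" "v \<in> Y" "w \<in> Y" for v w Y
    using small[OF that(3)] that X(1) by (metis IntI card_le_Suc0_iff_eq finite_Int One_nat_def)
  have inj: "inj_on f X" using f one by (metis inj_onI)
  have sub: "f ` X \<subseteq> \<B>" using f by auto
  have "r \<le> card \<B>" using card_inj_on_le[OF inj sub B(1)] X by simp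
  then show r: "card \<B> = r" using B by simp
  then have im: "f ` X = \<B>" using card_subset_eq[OF B(1) sub] card_image[OF inj] X by simp
  show "X \<inter> Y \<noteq> {}" if "Y \<in> \<B>" using that im f by blast
  have val: "f v = Y" if vY: "v \<in> X" "Y \<in> \<B>" "v \<in> Y" for v Y
  proof -
    obtain w where w: "w \<in> X" "f w = Y" using im vY(2) by blast
    then have "v = w" using f[OF w(1)] one[OF vY(1) w(1) vY(2,3)] by simp
    then show ?thesis using w by simp
  qed
  show "X \<inter> Y \<inter> Y' = {}" if "Y \<in> \<B>" "Y' \<in> \<B>" "Y \<noteq> Y'" using val that by blast
qed

text \<open>
  Here \<open>X \<inter> Y \<noteq> {}\<close> stands for \<open>card (X \<inter> Y) = 1\<close>, which is the same in a linear family.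
\<close>

definition grid :: "nat \<Rightarrow> 'a set set \<Rightarrow> 'a set set \<Rightarrow> bool" where
  "grid r \<A> \<B> \<longleftrightarrow> card \<A> = r \<and> card \<B> = r \<and> \<A> \<inter> \<B> = {} \<and> disjoint \<A> \<and> disjoint \<B> \<and>
     (\<forall>X\<in>\<A>. \<forall>Y\<in>\<B>. X \<inter> Y \<noteq> {})"

text \<open>
  Let \<open>\<A>\<close> and \<open>\<B>\<close> have the same union. An edge of \<open>\<A> - \<B>\<close> is covered by \<open>\<B>\<close> in single points, so it
  meets every member of \<open>\<B>\<close> in a point of its own, and symmetrically. A common member \<open>C\<close> of \<open>\<A>\<close> and
  \<open>\<B>\<close> would thus form a triangle with any two edges of \<open>\<A> - \<B>\<close> and \<open>\<B> - \<A>\<close>. Without common members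
  \<open>\<A>\<close> and \<open>\<B>\<close> form a grid.
\<close>

lemma union_free_if_no_triangle_no_grid:
  assumes r: "0 < r" and V: "finite V" and F: "uniform r V F"
    and lin: "\<And>A B. A \<in> F \<Longrightarrow> B \<in> F \<Longrightarrow> A \<noteq> B \<Longrightarrow> card (A \<inter> B) \<le> 1"
    and triangle_free: "\<And>A B C. A \<in> F \<Longrightarrow> B \<in> F \<Longrightarrow> C \<in> F \<Longrightarrow> A \<noteq> B \<Longrightarrow> A \<noteq> C \<Longrightarrow> B \<noteq> C \<Longrightarrow>
      A \<inter> B \<noteq> {} \<Longrightarrow> A \<inter> C \<noteq> {} \<Longrightarrow> B \<inter> C \<noteq> {} \<Longrightarrow> A \<inter> B \<inter> C \<noteq> {}"
    and grid_free: "\<And>\<A> \<B>. \<A> \<subseteq> F \<Longrightarrow> \<B> \<subseteq> F \<Longrightarrow> \<not> grid r \<A> \<B>"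
  shows "union_free r F"
proof -
  have key: False if sub: "\<A> \<subseteq> F" "\<B> \<subseteq> F" and card: "0 < card \<A>" "card \<A> \<le> r" "0 < card \<B>" "card \<B> \<le> r"
    and eq: "\<Union>\<A> = \<Union>\<B>" and A0: "A0 \<in> \<A> - \<B>" for \<A> \<B> A0
  proof -
    have fin: "finite \<A>" "finite \<B>" using card by (auto simp: card_gt_0_iff)
    have edge: "finite X" "card X = r" if "X \<in> F" for X
      using F V that by (auto simp: uniform_def intro: finite_subset)
    have cover: "card \<D> = r \<and> (\<forall>Y\<in>\<D>. X \<inter> Y \<noteq> {}) \<and> (\<forall>Y\<in>\<D>. \<forall>Y'\<in>\<D>. Y \<noteq> Y' \<longrightarrow> X \<inter> Y \<inter> Y' = {})"
      if "X \<in> \<C> - \<D>" "(\<C> = \<A> \<and> \<D> = \<B>) \<or> (\<C> = \<B> \<and> \<D> = \<A>)" for X \<C> \<D>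
    proof -
      have XF: "X \<in> F" and DF: "\<D> \<subseteq> F" "finite \<D>" "card \<D> \<le> r" and XD: "X \<subseteq> \<Union>\<D>"
        using that sub card fin eq by auto
      have "card (X \<inter> Y) \<le> 1" if "Y \<in> \<D>" for Y using that XF DF \<open>X \<in> \<C> - \<D>\<close> by (intro lin) auto
      from cover_by_small_intersections[OF edge[OF XF] XD DF(2,3) this] show ?thesis by blast
    qed
    have coverA: "X \<inter> Y \<noteq> {}" "Y' \<in> \<B> \<Longrightarrow> Y \<noteq> Y' \<Longrightarrow> X \<inter> Y \<inter> Y' = {}"
      if "X \<in> \<A> - \<B>" "Y \<in> \<B>" for X Y Y'
      using cover[of X \<A> \<B>] that by simp_all
    have coverB: "Y \<inter> X \<noteq> {}" "X' \<in> \<A> \<Longrightarrow> X \<noteq> X' \<Longrightarrow> Y \<inter> X \<inter> X' = {}"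
      if "Y \<in> \<B> - \<A>" "X \<in> \<A>" for X Y X'
      using cover[of Y \<B> \<A>] that by simp_all
    have crB: "card \<B> = r" using cover[OF A0] by simp
    have "\<not> \<B> \<subseteq> \<A>"
    proof
      assume "\<B> \<subseteq> \<A>"
      then have "\<B> = \<A>" using card_seteq[OF fin(1), of \<B>] crB card by simp
      then show False using A0 by blast
    qed
    then obtain B0 where B0: "B0 \<in> \<B> - \<A>" by blast
    have crA: "card \<A> = r" using cover[OF B0] by simp
    have disj: "\<A> \<inter> \<B> = {}"
    proof (rule ccontr)
      assume "\<A> \<inter> \<B> \<noteq> {}"
      then obtain C where C: "C \<in> \<A>" "C \<in> \<B>" by blast
      have "A0 \<inter> B0 \<noteq> {}" "A0 \<inter> C \<noteq> {}" "A0 \<inter> B0 \<inter> C = {}" using coverA[OF A0] B0 C by auto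
      moreover have "B0 \<inter> C \<noteq> {}" using coverB[OF B0] C by simp
      ultimately show False using triangle_free[of A0 B0 C] A0 B0 C sub by blast
    qed
    have "X \<inter> X' = {}" if X: "X \<in> \<A>" "X' \<in> \<A>" "X \<noteq> X'" for X X'
    proof (rule ccontr)
      assume "X \<inter> X' \<noteq> {}"
      then obtain v Y where v: "v \<in> X" "v \<in> X'" "Y \<in> \<B>" "v \<in> Y" using X(1) eq by blast
      then show False using coverB(2)[of Y X X'] disj X by blast
    qed
    moreover have "Y \<inter> Y' = {}" if Y: "Y \<in> \<B>" "Y' \<in> \<B>" "Y \<noteq> Y'" for Y Y'
    proof (rule ccontr)
      assume "Y \<inter> Y' \<noteq> {}"
      then obtain v X where v: "v \<in> Y" "v \<in> Y'" "X \<in> \<A>" "v \<in> X" using Y(1) eq by blast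
      then show False using coverA(2)[of X Y Y'] disj Y by blast
    qed
    moreover have "X \<inter> Y \<noteq> {}" if "X \<in> \<A>" "Y \<in> \<B>" for X Y using coverA(1)[of X Y] that disj by blast
    ultimately have "grid r \<A> \<B>" using crA crB disj by (auto simp: grid_def disjoint_def)
    then show False using grid_free sub by blast
  qed
  show ?thesis
    unfolding union_free_def
  proof (intro allI impI notI, elim conjE)
    fix \<A> \<B>
    assume *: "\<A> \<subseteq> F" "\<B> \<subseteq> F" "0 < card \<A>" "card \<A> \<le> r" "0 < card \<B>" "card \<B> \<le> r"
      "\<Union>\<A> = \<Union>\<B>" and "\<A> \<noteq> \<B>"
    then obtain A0 where "A0 \<in> \<A> - \<B> \<or> A0 \<in> \<B> - \<A>" by blast
    then show False using key[of \<A> \<B> A0] key[of \<B> \<A> A0] * by auto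
  qed
qed

section \<open>Rigidity of grids of lines\<close>

text \<open>
  Rows and columns are indexed by arbitrary sets, so that the two classes of edges of a grid can
  serve as indices themselves.
\<close>

definition latin :: "nat \<Rightarrow> 'i set \<Rightarrow> 'j set \<Rightarrow> ('i \<Rightarrow> 'j \<Rightarrow> nat) \<Rightarrow> bool" where
  "latin r I J L \<longleftrightarrow> finite I \<and> finite J \<and>
     (\<forall>i\<in>I. bij_betw (L i) J {..<r}) \<and> (\<forall>j\<in>J. bij_betw (\<lambda>i. L i j) I {..<r})"

lemma bij_betw_card_preimage:
  assumes "bij_betw f J B" "Z \<subseteq> B"
  shows "card {j \<in> J. f j \<in> Z} = card Z"
proof -
  have "f ` {j \<in> J. f j \<in> Z} = Z"
    using assms by (auto simp: bij_betw_def)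
  moreover have "inj_on f {j \<in> J. f j \<in> Z}"
    using assms by (auto simp: bij_betw_def inj_on_def)
  ultimately show ?thesis by (metis card_image)
qed

lemma latin_card_rows:
  assumes "latin r I J L" "J \<noteq> {}" shows "card I = r"
  using assms unfolding latin_def by (metis all_not_in_conv bij_betw_same_card card_lessThan)

lemma latin_card_cols:
  assumes "latin r I J L" "I \<noteq> {}" shows "card J = r"
  using assms unfolding latin_def by (metis all_not_in_conv bij_betw_same_card card_lessThan)

text \<open>
  Double counting the cells of \<open>R \<times> C\<close> that carry a symbol of \<open>Z\<close>. The hypothesis says that
  \<open>R \<union> C\<close> is a union of components of the bipartite graph on rows and columns whose edges are the
  cells with symbols in \<open>Z\<close>; this graph is regular of degree \<open>card Z\<close>.
\<close>

lemma latin_block: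
  assumes L: "latin r I J L" and Z: "Z \<subseteq> {..<r}" "Z \<noteq> {}"
    and RC: "R \<subseteq> I" "C \<subseteq> J"
    and closed: "\<forall>i\<in>I. \<forall>j\<in>J. L i j \<in> Z \<longrightarrow> (i \<in> R \<longleftrightarrow> j \<in> C)"
  shows "card R = card C"
    and "R \<noteq> {} \<Longrightarrow> card Z \<le> card R"
    and "card R = card Z \<Longrightarrow> i \<in> R \<Longrightarrow> j \<in> J \<Longrightarrow> L i j \<in> Z \<longleftrightarrow> j \<in> C"
proof -
  have fin: "finite I" "finite J" "finite R" "finite C" "finite Z"
    using L RC Z unfolding latin_def by (auto intro: finite_subset)
  have row: "card {j \<in> J. L i j \<in> Z} = card Z" if "i \<in> I" for i
    using L that Z(1) unfolding latin_def by (intro bij_betw_card_preimage) auto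
  have col: "card {i \<in> I. L i j \<in> Z} = card Z" if "j \<in> J" for j
    using L that Z(1) bij_betw_card_preimage[of "\<lambda>i. L i j" I "{..<r}" Z] unfolding latin_def by auto
  have "(SIGMA i:R. {j \<in> J. L i j \<in> Z}) = (\<lambda>(j, i). (i, j)) ` (SIGMA j:C. {i \<in> I. L i j \<in> Z})"
    using closed RC by (fastforce simp: image_iff)
  then have "card (SIGMA i:R. {j \<in> J. L i j \<in> Z}) = card (SIGMA j:C. {i \<in> I. L i j \<in> Z})"
    by (simp add: card_image inj_on_def)
  moreover have "card (SIGMA i:R. {j \<in> J. L i j \<in> Z}) = card R * card Z"
    using fin RC row by (subst card_SigmaI) (auto simp: subset_iff)
  moreover have "card (SIGMA j:C. {i \<in> I. L i j \<in> Z}) = card C * card Z"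
    using fin RC col by (subst card_SigmaI) (auto simp: subset_iff)
  ultimately show eq: "card R = card C"
    using fin Z(2) by simp
  have sub: "{j \<in> J. L i j \<in> Z} \<subseteq> C" if "i \<in> R" for i
    using that closed RC by auto
  show "card Z \<le> card R" if "R \<noteq> {}"
    using that sub row card_mono[OF fin(4)] eq RC by (metis all_not_in_conv subset_iff)
  show "L i j \<in> Z \<longleftrightarrow> j \<in> C" if "card R = card Z" "i \<in> R" "j \<in> J"
    using card_subset_eq[OF fin(4) sub[OF that(2)]] row[of i] that eq RC by auto
qed

text \<open>
  Functions \<open>f\<close> on the rows and \<open>g\<close> on the columns that agree along the cells with symbols in \<open>Z\<close> are
  constant on the components of the corresponding graph. Each component has at least
  \<open>r div 2\<close> rows, so for \<open>r \<ge> 4\<close> there are at most two of them, and if there are two then one has exactly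
  \<open>r div 2\<close> rows and is filled with the symbols of \<open>Z\<close>.
\<close>

lemma latin_level_sets:
  fixes f :: "'i \<Rightarrow> 'v" and g :: "'j \<Rightarrow> 'v"
  assumes L: "latin r I J L" and r: "4 \<le> r" and Z: "Z \<subseteq> {..<r}" "r div 2 \<le> card Z"
    and fg: "\<forall>i\<in>I. \<forall>j\<in>J. L i j \<in> Z \<longrightarrow> f i = g j"
    and nonconst: "\<not> (\<forall>i\<in>I. \<forall>j\<in>J. f i = g j)"
  obtains t t' where "t \<in> f ` I" "t' \<in> f ` I" "t \<noteq> t'" "\<And>i. i \<in> I \<Longrightarrow> f i = t \<or> f i = t'"
    "\<And>j. j \<in> J \<Longrightarrow> g j = t \<or> g j = t'" "card {i \<in> I. f i = t} = r div 2" "card Z = r div 2"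
    "card {j \<in> J. g j = t} = r div 2"
    "\<And>i j. i \<in> I \<Longrightarrow> f i = t \<Longrightarrow> j \<in> J \<Longrightarrow> L i j \<in> Z \<longleftrightarrow> g j = t"
proof -
  note result = that
  have Zne: "Z \<noteq> {}" using Z r by auto
  have fin: "finite I" "finite J" using L unfolding latin_def by auto
  have ne: "I \<noteq> {}" "J \<noteq> {}" using nonconst by auto
  have cI: "card I = r"
    using latin_card_rows[OF L] ne by auto
  define R where "R T = {i \<in> I. f i \<in> T}" for T
  define C where "C T = {j \<in> J. g j \<in> T}" for T
  have RC: "R T \<subseteq> I" "C T \<subseteq> J" and cl: "\<forall>i\<in>I. \<forall>j\<in>J. L i j \<in> Z \<longrightarrow> (i \<in> R T \<longleftrightarrow> j \<in> C T)" for T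
    using fg by (auto simp: R_def C_def)
  note blk = latin_block[OF L Z(1) Zne RC cl]
  have ge: "r div 2 \<le> card (R T)" if "R T \<noteq> {}" for T
    using blk(2)[OF that] Z(2) by simp
  have disj: "card (R T) + card (R T') \<le> card (R (T \<union> T'))" if "T \<inter> T' = {}" for T T'
  proof -
    have "R T \<union> R T' \<subseteq> R (T \<union> T')" "R T \<inter> R T' = {}" using that by (auto simp: R_def)
    moreover have "finite (R T)" for T using fin RC by (meson finite_subset)
    ultimately show ?thesis by (metis card_Un_disjoint card_mono)
  qed
  have le: "card (R T) \<le> r" for T using card_mono[OF fin(1) RC(1)[of T]] cI by simp
  have empty: "C T = {}" if "R T = {}" for T
    using blk(1)[of T] that fin RC by (metis card_eq_0_iff finite_subset card.empty)
  obtain i0 where i0: "i0 \<in> I" using ne by auto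
  define t1 where "t1 = f i0"
  have R1: "R {t1} \<noteq> {}" using i0 by (auto simp: R_def t1_def)
  have "R (-{t1}) \<noteq> {}"
  proof
    assume e: "R (-{t1}) = {}"
    with empty have "C (-{t1}) = {}" by blast
    with e nonconst show False by (auto simp: R_def C_def)
  qed
  then obtain i1 where i1: "i1 \<in> I" "f i1 \<noteq> t1" by (auto simp: R_def)
  define t2 where "t2 = f i1"
  have R2: "R {t2} \<noteq> {}" and t12: "t1 \<noteq> t2" using i1 by (auto simp: R_def t2_def)
  \<comment> \<open>Three level sets would need \<open>3 (r div 2) > r\<close> rows.\<close>
  have R3: "R (-{t1,t2}) = {}"
  proof (rule ccontr)
    assume "R (-{t1,t2}) \<noteq> {}"
    note ge[OF this]
    moreover have "card (R {t1}) + card (R {t2}) \<le> card (R {t1,t2})"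
      using disj[of "{t1}" "{t2}"] t12 by (simp add: insert_commute)
    moreover have "card (R {t1,t2}) + card (R (-{t1,t2})) \<le> card (R ({t1,t2} \<union> -{t1,t2}))"
      using disj[of "{t1,t2}" "-{t1,t2}"] by simp
    ultimately have "3 * (r div 2) \<le> r"
      using le[of "{t1,t2} \<union> -{t1,t2}"] ge[OF R1] ge[OF R2] by linarith
    then show False using r by presburger
  qed
  have C3: "C (-{t1,t2}) = {}" using R3 empty by blast
  have tot: "card (R {t1}) + card (R {t2}) \<le> r"
    using disj[of "{t1}" "{t2}"] t12 le[of "{t1,t2}"] by (simp add: insert_commute)
  have fin_step: thesis if t: "card (R {t}) \<le> card (R {t'})" "{t,t'} = {t1,t2}" for t t'
  proof (rule result)
    \<comment> \<open>The smaller of the two level sets has exactly \<open>r div 2\<close> rows, the minimum for any component.\<close>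
    have rn: "R {t} \<noteq> {}" using t R1 R2 by (auto simp: doubleton_eq_iff)
    have "card (R {t}) + card (R {t'}) \<le> r" using t tot by (auto simp: doubleton_eq_iff)
    then have ct: "card (R {t}) = r div 2" using ge[OF rn] t by linarith
    then show cz: "card Z = r div 2" using blk(2)[OF rn] Z by linarith
    show "card {i \<in> I. f i = t} = r div 2" using ct by (simp add: R_def)
    then show "card {j \<in> J. g j = t} = r div 2" using blk(1)[of "{t}"] by (simp add: R_def C_def)
    show "t \<in> f ` I" "t' \<in> f ` I" "t \<noteq> t'" using t R1 R2 t12 by (auto simp: doubleton_eq_iff R_def)
    show "f i = t \<or> f i = t'" if "i \<in> I" for i
    proof -
      have "i \<notin> R (-{t1,t2})" using R3 by blast
      then show ?thesis using that t(2) by (auto simp: R_def doubleton_eq_iff)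
    qed
    show "g j = t \<or> g j = t'" if "j \<in> J" for j
    proof -
      have "j \<notin> C (-{t1,t2})" using C3 by blast
      then show ?thesis using that t(2) by (auto simp: C_def doubleton_eq_iff)
    qed
    show "L i j \<in> Z \<longleftrightarrow> g j = t" if "i \<in> I" "f i = t" "j \<in> J" for i j
      using blk(3)[of "{t}" i j] ct cz that by (auto simp: R_def C_def)
  qed
  show thesis
  proof (cases "card (R {t1}) \<le> card (R {t2})")
    case True then show thesis by (intro fin_step[of t1 t2]) auto
  next
    case False then show thesis by (intro fin_step[of t2 t1]) auto
  qed
qed

text \<open>
  Two rows carry the same symbols in the columns \<open>C\<close>, so summing the congruences over \<open>C\<close> and cancelling
  \<open>card C\<close> gives \<open>u i \<equiv> u i'\<close>. A single column, in which the two symbols differ, then forces \<open>x \<equiv> 0\<close>.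
\<close>

lemma two_rows_incompatible:
  fixes u :: "'i \<Rightarrow> int" and v :: "'j \<Rightarrow> int" and h :: "nat \<Rightarrow> int"
  assumes p: "prime p" and C: "finite C" "\<not> p dvd int (card C)"
    and bij: "bij_betw (L i) C K" "bij_betw (L i') C K"
    and neq: "\<And>j. j \<in> C \<Longrightarrow> L i j \<noteq> L i' j"
    and h: "\<And>k l. k \<in> K \<Longrightarrow> l \<in> K \<Longrightarrow> p dvd h k - h l \<Longrightarrow> k = l"
    and eq: "\<And>j. j \<in> C \<Longrightarrow> p dvd u i - v j - x * h (L i j)"
      "\<And>j. j \<in> C \<Longrightarrow> p dvd u i' - v j - x * h (L i' j)"
  shows "p dvd x"
proof -
  have s: "(\<Sum>j\<in>C. h (L i j)) = (\<Sum>j\<in>C. h (L i' j))"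
    using sum.reindex_bij_betw[OF bij(1), of h] sum.reindex_bij_betw[OF bij(2), of h] by simp
  have "p dvd (\<Sum>j\<in>C. (u i - v j - x * h (L i j)) - (u i' - v j - x * h (L i' j)))"
    by (intro dvd_sum dvd_diff[OF eq]; assumption)
  also have "\<dots> = int (card C) * (u i - u i')"
    using s by (simp add: sum_subtractf sum.distrib sum_distrib_left[symmetric] algebra_simps)
  finally have d: "p dvd u i - u i'" using p C by (simp add: prime_dvd_mult_iff)
  have "C \<noteq> {}" using C by auto
  then obtain j where j: "j \<in> C" by blast
  have "p dvd (u i - u i') - ((u i - v j - x * h (L i j)) - (u i' - v j - x * h (L i' j)))"
    by (rule dvd_diff[OF d dvd_diff[OF eq[OF j]]])
  also have "\<dots> = x * (h (L i j) - h (L i' j))" by (simp add: algebra_simps)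
  finally have "p dvd x \<or> p dvd h (L i j) - h (L i' j)" using p by (simp add: prime_dvd_mult_iff)
  moreover have "L i j \<in> K" "L i' j \<in> K" using bij j by (auto simp: bij_betw_def)
  ultimately show ?thesis using h neq[OF j] by blast
qed

text \<open>
  The coefficients are distinct for \<open>r < p\<close>. Modulo \<open>p\<close> the first half vanishes and the others are
  distinct and nonzero; after division by \<open>p\<close> the first half is distinct and nonzero as well.
\<close>

definition coef :: "nat \<Rightarrow> nat \<Rightarrow> nat \<Rightarrow> nat" where
  "coef p r k = (if k < r div 2 then p * (k + 1) else k + 1)"

text \<open>
  The lines \<open>t \<mapsto> X i + t a i\<close> and \<open>t \<mapsto> Y j + t b j\<close> meet at \<open>t = c (L i j)\<close>.
\<close>

definition grid_solution ::
    "(nat \<Rightarrow> nat) \<Rightarrow> 'i set \<Rightarrow> 'j set \<Rightarrow> ('i \<Rightarrow> 'j \<Rightarrow> nat) \<Rightarrow>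
     ('i \<Rightarrow> int) \<Rightarrow> ('j \<Rightarrow> int) \<Rightarrow> ('i \<Rightarrow> int) \<Rightarrow> ('j \<Rightarrow> int) \<Rightarrow> bool" where
  "grid_solution c I J L X Y a b \<longleftrightarrow>
     (\<forall>i\<in>I. \<forall>j\<in>J. X i + int (c (L i j)) * a i = Y j + int (c (L i j)) * b j)"

lemma small_diff_not_dvd:
  fixes p r k l :: nat
  assumes "r < p" "k < r" "l < r" "int p dvd int k - int l" shows "k = l"
  using assms zdvd_imp_le[of "int p" "int k - int l"] zdvd_imp_le[of "int p" "int l - int k"]
  by (cases "k < l"; cases "l < k") (auto simp: dvd_diff_commute)

text \<open>
  Two applications of the same idea. The coefficients of the symbols below \<open>r div 2\<close> vanish modulo
  \<open>p\<close>, so \<open>X\<close> and \<open>Y\<close> agree along these symbols. If they took two values, the other symbols in a block of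
  at least two rows would contradict \<open>two_rows_incompatible\<close>; here the inverses of the
  coefficients play the role of \<open>h\<close>. Hence \<open>X\<close> and \<open>Y\<close> are constant modulo \<open>p\<close>, and then \<open>a\<close> and \<open>b\<close>
  agree along the remaining symbols, whose coefficients are invertible. If \<open>a\<close> and \<open>b\<close> took two values,
  there would be a block filled with symbols below \<open>r div 2\<close>. There the equations divided by \<open>p\<close> have
  the distinct coefficients \<open>1, 2, \<dots>\<close> and are contradictory for the same reason.
\<close>

lemma grid_solution_trivial_mod:
  assumes L: "latin r I J L" and r: "4 \<le> r" and p: "prime p" "r < p"
    and sol: "grid_solution (coef p r) I J L X Y a b"
  shows "\<forall>i\<in>I. \<forall>j\<in>J. int p dvd a i - b j \<and> int p dvd X i - Y j"
proof -
  define s where "s = r div 2"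
  have s: "2 \<le> s" "s < r" using r by (auto simp: s_def)
  have pp: "prime (int p)" using p by simp
  have finJ: "finite J" using L by (auto simp: latin_def)
  have eq: "X i - Y j = int (coef p r (L i j)) * (b j - a i)" if "i \<in> I" "j \<in> J" for i j
    using sol that by (auto simp: grid_solution_def algebra_simps)
  have Lr: "L i j < r" if "i \<in> I" "j \<in> J" for i j
    using L that by (auto simp: latin_def bij_betw_def)
  have Lneq: "L i j \<noteq> L i' j" if "i \<in> I" "i' \<in> I" "i \<noteq> i'" "j \<in> J" for i i' j
    using L that unfolding latin_def bij_betw_def inj_on_def by blast
  have notdvd: "\<not> int p dvd int k" if "0 < k" "k \<le> r" for k
    using that p zdvd_not_zless[of "int k" "int p"] by auto
  have Lbij: "bij_betw (L i) {j \<in> J. \<not> P j} K"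
    if "i \<in> I" "K \<subseteq> {..<r}" "\<And>j. j \<in> J \<Longrightarrow> L i j \<in> K \<longleftrightarrow> \<not> P j" for i P K
  proof (rule bij_betw_subset[where A = J])
    show "bij_betw (L i) J {..<r}" using L that by (auto simp: latin_def)
    then have im: "L i ` J = {..<r}" by (simp add: bij_betw_def)
    have "L i ` {j \<in> J. \<not> P j} = {l \<in> L i ` J. l \<in> K}" using that(3) by blast
    then show "L i ` {j \<in> J. \<not> P j} = K" unfolding im using that(2) by auto
  qed auto
  have two: "\<exists>i i'. i \<in> A \<and> i' \<in> A \<and> i \<noteq> i'" if "card A = s" for A :: "'i set"
    using that s by (metis card_le_Suc0_iff_eq card.infinite not_less_eq_eq numeral_2_eq_2 not_numeral_le_zero)

  \<comment> \<open>Along the symbols below \<open>s\<close>, whose coefficients vanish modulo \<open>p\<close>, the starts agree.\<close>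
  have XY: "int p dvd X i - Y j" if "i \<in> I" "j \<in> J" for i j
  proof (rule ccontr)
    let ?f = "\<lambda>i. X i mod int p" and ?g = "\<lambda>j. Y j mod int p"
    assume "\<not> int p dvd X i - Y j"
    then have nc: "\<not> (\<forall>i\<in>I. \<forall>j\<in>J. ?f i = ?g j)" using that by (auto simp: mod_eq_dvd_iff)
    have Z: "{..<s} \<subseteq> {..<r}" "r div 2 \<le> card {..<s}" using s by (auto simp: s_def)
    have fg: "\<forall>i\<in>I. \<forall>j\<in>J. L i j \<in> {..<s} \<longrightarrow> ?f i = ?g j"
      using eq by (auto simp: mod_eq_dvd_iff coef_def s_def)
    obtain t t' where t: "t \<in> ?f ` I" "t' \<in> ?f ` I" "t \<noteq> t'"
      and "\<And>i. i \<in> I \<Longrightarrow> ?f i = t \<or> ?f i = t'"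
      and g: "\<And>j. j \<in> J \<Longrightarrow> ?g j = t \<or> ?g j = t'"
      and cR: "card {i \<in> I. ?f i = t} = r div 2" and "card {..<s} = r div 2"
      and cC: "card {j \<in> J. ?g j = t} = r div 2"
      and LZ: "\<And>i j. i \<in> I \<Longrightarrow> ?f i = t \<Longrightarrow> j \<in> J \<Longrightarrow> L i j \<in> {..<s} \<longleftrightarrow> ?g j = t"
      by (rule latin_level_sets[OF L r Z fg nc]) (rule that)
    obtain i i' where i: "i \<in> I" "?f i = t" "i' \<in> I" "?f i' = t" "i \<noteq> i'"
      using two[of "{i \<in> I. ?f i = t}"] cR by (auto simp: s_def)
    define C where "C = {j \<in> J. ?g j \<noteq> t}"
    have CJ: "C = J - {j \<in> J. ?g j = t}" by (auto simp: C_def)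
    then have cC': "card C = r - s"
      using cC latin_card_cols[OF L] i finJ unfolding CJ by (subst card_Diff_subset) (auto simp: s_def)
    have "\<exists>y. int p dvd (int k + 1) * y - 1" if "k < r" for k
    proof -
      have "coprime (int k + 1) (int p)"
        using prime_imp_coprime[OF pp, of "int k + 1"] notdvd[of "k+1"] that
        by (simp add: coprime_commute add.commute)
      then show ?thesis using cong_solve_coprime_int by (metis cong_iff_dvd_diff)
    qed
    then obtain y where y: "\<And>k. k < r \<Longrightarrow> int p dvd (int k + 1) * y k - 1" by metis
    \<comment> \<open>Outside the block the equation reads \<open>c (b j - a i) = t - t'\<close> modulo \<open>p\<close>, and \<open>y\<close> inverts \<open>c\<close>.\<close>
    have main: "int p dvd a i - b j - (t' - t) * y (L i j)"
      if "i \<in> I" "?f i = t" "j \<in> C" for i j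
    proof -
      have j: "j \<in> J" "?g j = t'" "\<not> L i j < s" using that g LZ[of i j] by (auto simp: C_def)
      let ?k = "L i j"
      have e: "X i - Y j = (int ?k + 1) * (b j - a i)"
        using eq[of i j] that j by (auto simp: coef_def s_def algebra_simps)
      have "int p dvd X i - t" "int p dvd Y j - t'" using that j
        by (auto simp: mod_eq_dvd_iff[symmetric])
      then have "int p dvd (X i - t) - (Y j - t')" by (rule dvd_diff)
      then have "int p dvd y ?k * (((X i - t) - (Y j - t')) - 0) + ((int ?k + 1) * y ?k - 1) * (a i - b j)"
        using y[OF Lr[OF that(1) j(1)]] by (intro dvd_add) auto
      also have "\<dots> = - (a i - b j - (t' - t) * y ?k)" 
        using arg_cong[OF e, of "\<lambda>z. y ?k * z"] by (simp add: algebra_simps)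
      finally show ?thesis using dvd_minus_iff by blast
    qed
    have "int p dvd t' - t"
    proof (rule two_rows_incompatible[OF pp, of C L i "{s..<r}" i' y a b])
      show "finite C" using finJ by (simp add: C_def)
      show "\<not> int p dvd int (card C)" using notdvd[of "r - s"] cC' s by simp
      show "bij_betw (L i) C {s..<r}" "bij_betw (L i') C {s..<r}"
        unfolding C_def using i LZ Lr by (auto intro!: Lbij simp: not_less[symmetric])
      show "L i j \<noteq> L i' j" if "j \<in> C" for j using that i Lneq by (auto simp: C_def)
      show "k = l" if kl: "k \<in> {s..<r}" "l \<in> {s..<r}" "int p dvd y k - y l" for k l
      proof -
        have "int p dvd (int k + 1) * (int l + 1) * (y k - y l)" using kl by simp
        moreover have "int p dvd (int l + 1) * ((int k + 1) * y k - 1)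
            - (int k + 1) * ((int l + 1) * y l - 1)"
          by (rule dvd_diff[OF dvd_mult[OF y] dvd_mult[OF y]]) (use kl in auto)
        ultimately have "int p dvd (int k + 1) * (int l + 1) * (y k - y l) -
            ((int l + 1) * ((int k + 1) * y k - 1) - (int k + 1) * ((int l + 1) * y l - 1))"
          by (rule dvd_diff)
        also have "\<dots> = int l - int k" by (simp add: algebra_simps)
        finally show "k = l" using small_diff_not_dvd[OF p(2), of l k] kl by auto
      qed
    qed (use main i in auto)
    then have "t' mod int p = t mod int p" by (simp add: mod_eq_dvd_iff)
    then show False using t by auto
  qed

  \<comment> \<open>The left-hand side \<open>X i - Y j\<close> vanishes modulo \<open>p\<close>, so \<open>a\<close> and \<open>b\<close> agree along the symbols from \<open>s\<close> on.\<close>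
  have ab: "int p dvd a i - b j" if "i \<in> I" "j \<in> J" for i j
  proof (rule ccontr)
    let ?f = "\<lambda>i. a i mod int p" and ?g = "\<lambda>j. b j mod int p"
    assume "\<not> int p dvd a i - b j"
    then have nc: "\<not> (\<forall>i\<in>I. \<forall>j\<in>J. ?f i = ?g j)" using that by (auto simp: mod_eq_dvd_iff)
    have Z: "{s..<r} \<subseteq> {..<r}" "r div 2 \<le> card {s..<r}" using s by (auto simp: s_def)
    have fg: "\<forall>i\<in>I. \<forall>j\<in>J. L i j \<in> {s..<r} \<longrightarrow> ?f i = ?g j"
    proof (intro ballI impI)
      fix i j assume that: "i \<in> I" "j \<in> J" "L i j \<in> {s..<r}"
      have "int p dvd int (L i j + 1) * (b j - a i)"
        using XY[of i j] eq[of i j] that by (auto simp: coef_def s_def)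
      then have "int p dvd b j - a i"
        using pp notdvd[of "L i j + 1"] that by (subst (asm) prime_dvd_mult_iff) auto
      then show "?f i = ?g j" by (simp add: mod_eq_dvd_iff dvd_diff_commute)
    qed
    obtain t t' where t: "t \<in> ?f ` I" "t' \<in> ?f ` I" "t \<noteq> t'"
      and "\<And>i. i \<in> I \<Longrightarrow> ?f i = t \<or> ?f i = t'"
      and g: "\<And>j. j \<in> J \<Longrightarrow> ?g j = t \<or> ?g j = t'"
      and cR: "card {i \<in> I. ?f i = t} = r div 2" and cZ: "card {s..<r} = r div 2"
      and cC: "card {j \<in> J. ?g j = t} = r div 2"
      and LZ: "\<And>i j. i \<in> I \<Longrightarrow> ?f i = t \<Longrightarrow> j \<in> J \<Longrightarrow> L i j \<in> {s..<r} \<longleftrightarrow> ?g j = t"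
      by (rule latin_level_sets[OF L r Z fg nc]) (rule that)
    obtain i i' where i: "i \<in> I" "?f i = t" "i' \<in> I" "?f i' = t" "i \<noteq> i'"
      using two[of "{i \<in> I. ?f i = t}"] cR by (auto simp: s_def)
    define C where "C = {j \<in> J. ?g j \<noteq> t}"
    have CJ: "C = J - {j \<in> J. ?g j = t}" by (auto simp: C_def)
    then have cC': "card C = s"
      using cC cZ latin_card_cols[OF L] i finJ unfolding CJ by (subst card_Diff_subset) (auto simp: s_def)
    obtain j0 where j0: "j0 \<in> J" using \<open>j \<in> J\<close> by blast
    \<comment> \<open>First-order terms of the starts, relative to an arbitrary reference column.\<close>
    define u where "u i = (X i - Y j0) div int p" for i
    define v where "v j = (Y j - Y j0) div int p" for j
    have Xu: "X i - Y j0 = int p * u i" if "i \<in> I" for i using XY[OF that j0] by (simp add: u_def)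
    have Yv: "Y j - Y j0 = int p * v j" if "j \<in> J" for j
    proof -
      have "int p dvd (X i - Y j0) - (X i - Y j)" using XY i that j0 by (metis dvd_diff)
      then show ?thesis by (simp add: v_def)
    qed
    have main: "int p dvd u i - v j - (t' - t) * (int (L i j) + 1)"
      if "i \<in> I" "?f i = t" "j \<in> C" for i j
    proof -
      have j: "j \<in> J" "?g j = t'" using that g by (auto simp: C_def)
      have k: "L i j < s" using that j LZ[of i j] Lr[of i j] t by (auto simp: C_def)
      have "int p * (u i - v j) = X i - Y j"
        using Xu[OF that(1)] Yv[OF j(1)] by (simp add: algebra_simps)
      also have "\<dots> = int p * ((int (L i j) + 1) * (b j - a i))"
        using eq[OF that(1) j(1)] k by (simp add: coef_def s_def algebra_simps)
      finally have e: "u i - v j = (int (L i j) + 1) * (b j - a i)" using p by auto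
      have "int p dvd a i - t" "int p dvd b j - t'" using that j
        by (auto simp: mod_eq_dvd_iff[symmetric])
      then have "int p dvd (int (L i j) + 1) * ((b j - t') - (a i - t))"
        by (intro dvd_mult dvd_diff[of _ "b j - t'" "a i - t"])
      then show ?thesis unfolding e by (simp add: algebra_simps)
    qed
    have "int p dvd t' - t"
    proof (rule two_rows_incompatible[OF pp, of C L i "{..<s}" i' "\<lambda>k. int k + 1" u v])
      show "finite C" using finJ by (simp add: C_def)
      show "\<not> int p dvd int (card C)" using notdvd[of s] cC' s by simp
      have "L i'' j \<in> {..<s} \<longleftrightarrow> ?g j \<noteq> t" if "i'' \<in> {i, i'}" "j \<in> J" for i'' j
        using LZ[of i'' j] Lr[of i'' j] i that by auto
      then show "bij_betw (L i) C {..<s}" "bij_betw (L i') C {..<s}"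
        unfolding C_def using i s by (auto intro!: Lbij)
      show "L i j \<noteq> L i' j" if "j \<in> C" for j using that i Lneq by (auto simp: C_def)
      show "k = l" if "k \<in> {..<s}" "l \<in> {..<s}" "int p dvd int k + 1 - (int l + 1)" for k l
        using small_diff_not_dvd[OF p(2), of k l] that s by auto
    qed (use main i in auto)
    then have "t' mod int p = t mod int p" by (simp add: mod_eq_dvd_iff)
    then show False using t by auto
  qed
  show ?thesis using XY ab by blast
qed

text \<open>
  Infinite descent: modulo \<open>p\<close> all slopes agree and all starts agree, so after subtracting these
  constants the solution can be divided by \<open>p\<close>. The difference \<open>a i - b j\<close> is thus divisible by
  all powers of \<open>p\<close>.
\<close>

lemma grid_solution_trivial:
  assumes L: "latin r I J L" and r: "4 \<le> r" and p: "prime p" "r < p"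
    and sol: "grid_solution (coef p r) I J L X Y a b" and ij: "i \<in> I" "j \<in> J"
  shows "a i = b j"
proof -
  have "int p ^ n dvd a i - b j" for n
    using sol ij
  proof (induction n arbitrary: X Y a b i j)
    case 0 then show ?case by simp
  next
    case (Suc n)
    note m = grid_solution_trivial_mod[OF L r p Suc.prems(1)]
    define a' where "a' k = (a k - a i) div int p" for k
    define b' where "b' k = (b k - a i) div int p" for k
    define X' where "X' k = (X k - X i) div int p" for k
    define Y' where "Y' k = (Y k - X i) div int p" for k
    have b: "b k = a i + int p * b' k" "Y k = X i + int p * Y' k" if "k \<in> J" for k
      using m Suc.prems(2) that by (auto simp: b'_def Y'_def dvd_diff_commute)
    have "int p dvd (a k - b j) - (a i - b j)" "int p dvd (X k - Y j) - (X i - Y j)" if "k \<in> I" for k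
      using m Suc.prems that by - (rule dvd_diff, blast, blast)+
    then have a: "a k = a i + int p * a' k" "X k = X i + int p * X' k" if "k \<in> I" for k
      using that by (auto simp: a'_def X'_def)
    have "grid_solution (coef p r) I J L X' Y' a' b'"
      unfolding grid_solution_def
    proof (intro ballI)
      fix k l assume kl: "k \<in> I" "l \<in> J"
      let ?c = "int (coef p r (L k l))"
      have "X k + ?c * a k = Y l + ?c * b l" using Suc.prems(1) kl by (simp add: grid_solution_def)
      then have "int p * (X' k + ?c * a' k) = int p * (Y' l + ?c * b' l)"
        using a[OF kl(1)] b[OF kl(2)] by (simp add: algebra_simps)
      then show "X' k + ?c * a' k = Y' l + ?c * b' l" using p by auto
    qed
    from Suc.IH[OF this Suc.prems(2,3)] have "int p * int p ^ n dvd int p * (a' i - b' j)"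
      by (rule mult_dvd_mono[OF dvd_refl])
    moreover have "int p * (a' i - b' j) = a i - b j"
      using a(1)[OF Suc.prems(2)] b(1)[OF Suc.prems(3)] by (simp add: algebra_simps)
    ultimately show ?case by simp
  qed
  moreover have "\<bar>a i - b j\<bar> < int p ^ nat \<bar>a i - b j\<bar>"
    using of_nat_less_iff[of "nat \<bar>a i - b j\<bar>" "p ^ nat \<bar>a i - b j\<bar>", where 'a = int] p
      power_gt_expt[of p "nat \<bar>a i - b j\<bar>"] r by simp
  ultimately show ?thesis
    using dvd_imp_le_int[of "a i - b j" "int p ^ nat \<bar>a i - b j\<bar>"] by fastforce
qed

section \<open>Behrend sets\<close>

text \<open>
  Signed digits smaller than the base: uniqueness of the expansion of zero. Differences of ordinary
  expansions as well as linear combinations with small coefficients are of this form.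
\<close>

lemma balanced_digits_zero:
  fixes e :: "nat \<Rightarrow> int" and B :: int
  assumes "(\<Sum>d<D. e d * B ^ d) = 0" "\<And>d. d < D \<Longrightarrow> \<bar>e d\<bar> < B"
  shows "d < D \<Longrightarrow> e d = 0"
  using assms
proof (induction D arbitrary: e d)
  case 0 then show ?case by simp
next
  case (Suc D)
  have B: "0 < B" using Suc.prems(3)[of 0] by simp
  have split: "e 0 + B * (\<Sum>d<D. e (Suc d) * B ^ d) = 0"
    using Suc.prems(2) by (simp add: sum.lessThan_Suc_shift sum_distrib_left mult_ac del: sum.lessThan_Suc)
  then have "B dvd e 0" by (metis add.commute add_eq_0_iff dvd_minus_iff dvd_triv_left)
  then have e0: "e 0 = 0" using Suc.prems(3)[of 0] dvd_imp_le_int[of "e 0" B] by force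
  then have "(\<Sum>d<D. e (Suc d) * B ^ d) = 0" using split B by simp
  from Suc.IH[of _ "\<lambda>d. e (Suc d)", OF _ this] Suc.prems(3) have "e (Suc d) = 0" if "d < D" for d
    using that by simp
  then show ?case using e0 Suc.prems(1) by (cases d) auto
qed

lemma digits_less_power:
  fixes v :: "nat \<Rightarrow> nat"
  assumes "\<And>d. d < D \<Longrightarrow> v d < B"
  shows "(\<Sum>d<D. v d * B ^ d) < B ^ D"
  using assms
proof (induction D)
  case (Suc D)
  have "(\<Sum>d<Suc D. v d * B ^ d) < B ^ D + v D * B ^ D" using Suc by simp
  also have "\<dots> = Suc (v D) * B ^ D" by simp
  also have "\<dots> \<le> B * B ^ D" using Suc.prems[of D] by (intro mult_le_mono1) auto
  finally show ?case by simp
qed simp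

text \<open>
  With \<open>\<gamma> = - (\<alpha> + \<beta>)\<close> the identity
  \<open>(\<alpha> + \<beta>) (\<alpha> u\<^sup>2 + \<beta> v\<^sup>2) - (\<alpha> u + \<beta> v)\<^sup>2 = \<alpha> \<beta> (u - v)\<^sup>2\<close>, summed over all coordinates, expresses
  \<open>\<alpha> \<beta> |u - v|\<^sup>2\<close> through the three equal norms, and the coefficients of \<open>R\<close> cancel. This is the
  strict convexity of the sphere for arbitrary signs of the weights.
\<close>

lemma sphere_no_affine_relation:
  fixes u v w :: "nat \<Rightarrow> int" and \<alpha> \<beta> \<gamma> R :: int
  assumes sph: "(\<Sum>d<D. (u d)\<^sup>2) = R" "(\<Sum>d<D. (v d)\<^sup>2) = R" "(\<Sum>d<D. (w d)\<^sup>2) = R"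
    and coeffs: "\<alpha> \<noteq> 0" "\<beta> \<noteq> 0" "\<gamma> \<noteq> 0" "\<alpha> + \<beta> + \<gamma> = 0"
    and rel: "\<And>d. d < D \<Longrightarrow> \<alpha> * u d + \<beta> * v d + \<gamma> * w d = 0"
    and d: "d < D"
  shows "u d = v d" "v d = w d"
proof -
  have \<gamma>: "\<gamma> = - (\<alpha> + \<beta>)" using coeffs by simp
  have "(\<Sum>d<D. \<alpha> * \<beta> * (u d - v d)\<^sup>2) = (\<Sum>d<D. - \<gamma> * (\<alpha> * (u d)\<^sup>2 + \<beta> * (v d)\<^sup>2 + \<gamma> * (w d)\<^sup>2))"
  proof (intro sum.cong refl)
    fix d assume "d \<in> {..<D}"
    then have "\<gamma> * w d = - (\<alpha> * u d + \<beta> * v d)" using rel[of d] by simp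
    then have "(\<gamma> * w d)\<^sup>2 = (\<alpha> * u d + \<beta> * v d)\<^sup>2" by (simp only: power2_minus)
    then show "\<alpha> * \<beta> * (u d - v d)\<^sup>2 = - \<gamma> * (\<alpha> * (u d)\<^sup>2 + \<beta> * (v d)\<^sup>2 + \<gamma> * (w d)\<^sup>2)"
      by (simp add: \<gamma> power2_eq_square algebra_simps)
  qed
  also have "\<dots> = - \<gamma> * (\<alpha> * R + \<beta> * R + \<gamma> * R)"
    by (simp only: sum_distrib_left[symmetric] sum.distrib sph)
  also have "\<dots> = 0" by (simp add: \<gamma> algebra_simps)
  finally have "(\<Sum>d<D. (u d - v d)\<^sup>2) = 0"
    using coeffs by (simp add: sum_distrib_left[symmetric])
  then show uv: "u d = v d" using d by (simp add: sum_nonneg_eq_0_iff)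
  have "\<gamma> * (w d - v d) = 0" using rel[OF d] uv by (simp add: \<gamma> algebra_simps)
  then show "v d = w d" using coeffs by simp
qed

text \<open>
  No nontrivial solutions of any linear equation in three variables whose coefficients are nonzero,
  have sum zero and are at most \<open>Q\<close> in absolute value; with coefficients \<open>1, 1, -2\<close>, no three-term progressions.
\<close>

definition affine_free :: "int \<Rightarrow> nat set \<Rightarrow> bool" where
  "affine_free Q S \<longleftrightarrow> (\<forall>a\<in>S. \<forall>b\<in>S. \<forall>c\<in>S. \<forall>\<alpha> \<beta> \<gamma>.
     \<alpha> \<noteq> 0 \<and> \<beta> \<noteq> 0 \<and> \<gamma> \<noteq> 0 \<and> \<bar>\<alpha>\<bar> \<le> Q \<and> \<bar>\<beta>\<bar> \<le> Q \<and> \<bar>\<gamma>\<bar> \<le> Q \<and> \<alpha> + \<beta> + \<gamma> = 0 \<and>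
     \<alpha> * int a + \<beta> * int b + \<gamma> * int c = 0 \<longrightarrow> a = b \<and> b = c)"

text \<open>
  The base \<open>B\<close> is so large that a relation between the numbers involves no carries and therefore
  holds for each digit.
\<close>

lemma affine_free_digit_sphere:
  fixes D K B Q R :: nat
  assumes Q: "0 < Q" and B: "3 * Q * K \<le> B"
    and V: "V = {v \<in> {..<D} \<rightarrow>\<^sub>E {..<K}. (\<Sum>d<D. (v d)\<^sup>2) = R}"
    and S: "S = (\<lambda>v. \<Sum>d<D. v d * B ^ d) ` V"
  shows "affine_free (int Q) S" and "card S = card V" and "\<forall>a\<in>S. a < B ^ D"
proof -
  have lt: "v d < K" if "v \<in> V" "d < D" for v d using that V by (auto simp: PiE_iff)
  have KB: "K \<le> B" 
  proof -
    have "1 * K \<le> 3 * Q * K" using Q by (intro mult_le_mono1) linarith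
    also note B
    finally show ?thesis by simp
  qed
  have sq: "(\<Sum>d<D. (int (v d))\<^sup>2) = int R" if "v \<in> V" for v
    using that by (auto simp: V simp flip: of_nat_sum of_nat_power)
  have inj: "inj_on (\<lambda>v. \<Sum>d<D. v d * B ^ d) V"
  proof (rule inj_onI)
    fix v w assume vw: "v \<in> V" "w \<in> V" "(\<Sum>d<D. v d * B ^ d) = (\<Sum>d<D. w d * B ^ d)"
    then have "int (\<Sum>d<D. v d * B ^ d) = int (\<Sum>d<D. w d * B ^ d)" by simp
    then have "(\<Sum>d<D. (int (v d) - int (w d)) * int B ^ d) = 0"
      by (simp add: left_diff_distrib sum_subtractf)
    moreover have "\<bar>int (v d) - int (w d)\<bar> < int B" if "d < D" for d
      using lt[OF vw(1) that] lt[OF vw(2) that] KB by linarith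
    ultimately have "int (v d) - int (w d) = 0" if "d < D" for d
      using balanced_digits_zero[of "\<lambda>d. int (v d) - int (w d)" "int B" D d] that by blast
    then show "v = w" using vw V by (intro PiE_ext[of v "{..<D}" "\<lambda>_. {..<K}" w]) auto
  qed
  then show "card S = card V" unfolding S by (rule card_image)
  show "\<forall>a\<in>S. a < B ^ D" 
  proof
    fix a assume "a \<in> S"
    then obtain v where v: "v \<in> V" "a = (\<Sum>d<D. v d * B ^ d)" unfolding S by blast
    show "a < B ^ D" unfolding v(2) by (rule digits_less_power[OF less_le_trans[OF lt[OF v(1)] KB]])
  qed
  show "affine_free (int Q) S"
    unfolding affine_free_def
  proof (intro ballI allI impI)
    fix a b c \<alpha> \<beta> \<gamma>
    assume abc: "a \<in> S" "b \<in> S" "c \<in> S"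
    assume *: "\<alpha> \<noteq> 0 \<and> \<beta> \<noteq> 0 \<and> \<gamma> \<noteq> 0 \<and> \<bar>\<alpha>\<bar> \<le> int Q \<and> \<bar>\<beta>\<bar> \<le> int Q \<and> \<bar>\<gamma>\<bar> \<le> int Q \<and>
      \<alpha> + \<beta> + \<gamma> = 0 \<and> \<alpha> * int a + \<beta> * int b + \<gamma> * int c = 0"
    obtain u v w where uvw: "u \<in> V" "v \<in> V" "w \<in> V"
      and a: "a = (\<Sum>d<D. u d * B ^ d)" and b: "b = (\<Sum>d<D. v d * B ^ d)" and c: "c = (\<Sum>d<D. w d * B ^ d)"
      using abc unfolding S by auto
    let ?e = "\<lambda>d. \<alpha> * int (u d) + \<beta> * int (v d) + \<gamma> * int (w d)"
    have "(\<Sum>d<D. ?e d * int B ^ d) = \<alpha> * int a + \<beta> * int b + \<gamma> * int c"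
      by (simp add: a b c algebra_simps sum.distrib sum_distrib_left)
    then have sum0: "(\<Sum>d<D. ?e d * int B ^ d) = 0" using * by simp
    have bound: "\<bar>?e d\<bar> < int B" if "d < D" for d
    proof -
      have t: "\<bar>\<delta> * int (x d)\<bar> < int Q * int K" if "x \<in> V" "\<bar>\<delta>\<bar> \<le> int Q" for x \<delta>
      proof -
        have "\<bar>\<delta> * int (x d)\<bar> = \<bar>\<delta>\<bar> * int (x d)" by (simp add: abs_mult)
        also have "\<dots> \<le> int Q * int (x d)" using that by (intro mult_right_mono) auto
        also have "\<dots> < int Q * int K" using lt[OF that(1) \<open>d < D\<close>] Q by simp
        finally show ?thesis .
      qed
      have "\<bar>?e d\<bar> \<le> \<bar>\<alpha> * int (u d)\<bar> + \<bar>\<beta> * int (v d)\<bar> + \<bar>\<gamma> * int (w d)\<bar>"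
        by (intro order.trans[OF abs_triangle_ineq] add_mono abs_triangle_ineq order.refl)
      also have "\<dots> < int Q * int K + int Q * int K + int Q * int K"
        using * by (intro add_strict_mono t uvw) auto
      also have "\<dots> = int (3 * Q * K)" by simp
      also have "\<dots> \<le> int B" using B by (simp only: of_nat_le_iff)
      finally show ?thesis .
    qed
    have rel: "\<And>d. d < D \<Longrightarrow> ?e d = 0" using balanced_digits_zero[OF sum0 bound] by simp
    have "int (u d) = int (v d) \<and> int (v d) = int (w d)" if "d < D" for d
      using sphere_no_affine_relation[OF sq[OF uvw(1)] sq[OF uvw(2)] sq[OF uvw(3)], of \<alpha> \<beta> \<gamma>] rel * that by blast
    then show "a = b \<and> b = c" by (auto simp: a b c)
  qed
qed

text \<open>
  Among the \<open>K\<^sup>D\<close> digit vectors with \<open>K = 2\<^sup>D\<close>, some sphere contains at least the average number.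
  There are at most \<open>D K\<^sup>2 \<le> 2\<^bsup>3 D\<^esup>\<close> spheres.
\<close>

lemma affine_free_power_two:
  assumes Q: "0 < Q" "4 * Q \<le> 2 ^ q" and D: "0 < D"
  obtains S where "affine_free (int Q) S" "finite S" "2 ^ D\<^sup>2 \<le> card S * 2 ^ (3 * D)"
    "\<And>a. a \<in> S \<Longrightarrow> Q * a < 2 ^ (D + q)\<^sup>2"
proof -
  define K B :: nat where "K = 2 ^ D" and "B = 2 ^ (D + q)"
  let ?N = "\<lambda>v :: nat \<Rightarrow> nat. \<Sum>d<D. (v d)\<^sup>2" and ?A = "{..<D} \<rightarrow>\<^sub>E {..<K}" and ?T = "{..<D * K\<^sup>2}"
  have K: "0 < K" by (simp add: K_def)
  have "?N v < D * K\<^sup>2" if "v \<in> ?A" for v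
  proof -
    have "?N v < (\<Sum>d<D. K\<^sup>2)" using that D
      by (intro sum_strict_mono) (auto simp: PiE_iff intro!: power_strict_mono)
    then show ?thesis by simp
  qed
  then have "?N \<in> ?A \<rightarrow> ?T" by auto
  moreover have "finite ?A" by (intro finite_PiE) auto
  moreover have "?T \<noteq> {}" by (metis D K lessThan_iff empty_iff nat_0_less_mult_iff zero_less_power)
  ultimately obtain R where R: "card ?A \<le> card (?N -` {R} \<inter> ?A) * card ?T"
    using pigeonhole_card[of ?N ?A ?T] by auto
  define V where "V = {v \<in> ?A. ?N v = R}"
  define S where "S = (\<lambda>v. \<Sum>d<D. v d * B ^ d) ` V"
  have VR: "?N -` {R} \<inter> ?A = V" by (auto simp: V_def)
  have "finite V" unfolding V_def by (intro finite_subset[OF _ finite_PiE[of "{..<D}" "\<lambda>_. {..<K}"]]) auto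
  then have finS: "finite S" by (simp add: S_def)
  have "3 * Q * K \<le> 4 * Q * K" by simp
  also have "\<dots> \<le> 2 ^ q * K" using Q by (intro mult_le_mono1)
  finally have "3 * Q * K \<le> B" by (simp add: B_def K_def power_add mult.commute)
  note S = affine_free_digit_sphere[OF Q(1) this V_def S_def]
  have "D * K\<^sup>2 \<le> 2 ^ D * 2 ^ (2 * D)"
    by (intro mult_le_mono) (auto simp: K_def power_mult[symmetric] mult.commute less_imp_le[OF less_exp])
  then have "D * K\<^sup>2 \<le> 2 ^ (3 * D)" by (simp add: power_add[symmetric])
  moreover have "card ?A = 2 ^ D\<^sup>2" by (simp add: card_PiE K_def power_mult[symmetric] power2_eq_square)
  ultimately have "2 ^ D\<^sup>2 \<le> card S * 2 ^ (3 * D)"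
    using R S(2) unfolding VR by (metis card_lessThan le_trans mult_le_mono2)
  moreover have "Q * a < 2 ^ (D + q)\<^sup>2" if "a \<in> S" for a
  proof -
    have "Q * a < Q * B ^ D" using S(3) that Q by simp
    also have "\<dots> \<le> 2 ^ q * B ^ D" using Q by (intro mult_le_mono1) linarith
    also have "\<dots> = 2 ^ (q + (D + q) * D)" by (simp add: B_def power_add power_mult)
    also have "\<dots> \<le> 2 ^ (D + q)\<^sup>2"
    proof (rule power_increasing)
      have "q \<le> (D + q) * q" using D by simp
      then show "q + (D + q) * D \<le> (D + q)\<^sup>2" by (simp add: power2_eq_square algebra_simps)
    qed simp
    finally show ?thesis .
  qed
  ultimately show thesis using that S(1) finS by blast
qed

text \<open>
  Choose \<open>E\<close> with \<open>2\<^bsup>E\<^sup>2\<^esup> \<le> m < 2\<^bsup>(E + 1)\<^sup>2\<^esup>\<close> and let \<open>D = E - q\<close>, where \<open>2\<^sup>q\<close> exceeds the coefficients. The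
  construction loses a factor \<open>2\<^bsup>O(E)\<^esup>\<close> and \<open>E\<close> is of order \<open>sqrt (ln m)\<close>. If \<open>E \<le> q\<close> then \<open>m\<close> is
  bounded and the set \<open>{0}\<close> is large enough.
\<close>

lemma behrend:
  assumes Q: "0 < Q"
  obtains \<gamma> :: real where "0 < \<gamma>"
    "\<And>m. 0 < m \<Longrightarrow> \<exists>S. affine_free (int Q) S \<and> finite S \<and> (\<forall>a\<in>S. Q * a < m) \<and>
       real m * exp (- \<gamma> * sqrt (ln (real m))) \<le> real (card S)"
proof -
  obtain q where q: "4 * Q \<le> 2 ^ q" using less_imp_le[OF less_exp] by blast
  define \<gamma> :: real where "\<gamma> = 2 * real q + 6"
  have "\<exists>S. affine_free (int Q) S \<and> finite S \<and> (\<forall>a\<in>S. Q * a < m) \<and>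
       real m * exp (- \<gamma> * sqrt (ln (real m))) \<le> real (card S)" if m: "0 < m" for m
  proof -
    define E where "E = Max {E. 2 ^ E\<^sup>2 \<le> m}"
    have "{E. 2 ^ E\<^sup>2 \<le> m} \<subseteq> {..m}"
    proof
      fix E assume "E \<in> {E. 2 ^ E\<^sup>2 \<le> m}"
      then have "2 ^ E\<^sup>2 \<le> m" by simp
      moreover have "E \<le> E\<^sup>2" by (simp add: power2_eq_square)
      moreover have "E\<^sup>2 < 2 ^ E\<^sup>2" by (rule less_exp)
      ultimately show "E \<in> {..m}" unfolding atMost_iff by linarith
    qed
    then have fin: "finite {E. 2 ^ E\<^sup>2 \<le> m}" by (rule finite_subset) simp
    moreover have "0 \<in> {E. 2 ^ E\<^sup>2 \<le> m}" using m by simp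
    ultimately have E: "2 ^ E\<^sup>2 \<le> m" using Max_in unfolding E_def by blast
    have E1: "m < 2 ^ (E + 1)\<^sup>2"
      using Max_ge[OF fin, of "E + 1"] unfolding E_def[symmetric] by (auto simp: not_le[symmetric])
    have ln2: "0 < ln (2::real)" "ln (2::real) \<le> 1" using ln_2_less_1 by auto
    have "real (2 ^ E\<^sup>2) \<le> real m" using E by (simp only: of_nat_le_iff)
    then have "ln (2 ^ E\<^sup>2) \<le> ln (real m)" using m by (subst ln_le_cancel_iff) auto
    then have lo: "real (E\<^sup>2) * ln 2 \<le> ln (real m)" by (simp add: ln_realpow)
    have "real m < real (2 ^ (E + 1)\<^sup>2)" using E1 by (simp only: of_nat_less_iff)
    then have "ln (real m) \<le> ln (2 ^ (E + 1)\<^sup>2)" using m by (subst ln_le_cancel_iff) auto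
    then have hi: "ln (real m) \<le> real ((E + 1)\<^sup>2) * ln 2" by (simp add: ln_realpow)
    have em: "real m * exp (- \<gamma> * sqrt (ln (real m))) = exp (ln (real m) - \<gamma> * sqrt (ln (real m)))"
      using m by (simp add: exp_diff exp_minus divide_inverse)
    show ?thesis
    proof (cases "E \<le> q")
      case True
      let ?l = "ln (real m)"
      have l0: "0 \<le> ?l" using m by simp
      have "real ((E + 1)\<^sup>2) * ln 2 \<le> real ((E + 1)\<^sup>2) * 1" using ln2 by (intro mult_left_mono) auto
      with hi have "?l \<le> real ((E + 1)\<^sup>2) * 1" by linarith
      also have "\<dots> \<le> \<gamma>\<^sup>2"
      proof -
        have "real (E + 1) \<le> \<gamma>" using True by (simp add: \<gamma>_def)
        then have "(real (E + 1))\<^sup>2 \<le> \<gamma>\<^sup>2" by (rule power_mono) simp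
        then show ?thesis by (simp only: of_nat_power mult_1_right)
      qed
      finally have "sqrt ?l \<le> \<gamma>" by (intro real_le_lsqrt) (auto simp: \<gamma>_def l0)
      then have "sqrt ?l * sqrt ?l \<le> \<gamma> * sqrt ?l" using l0 by (intro mult_right_mono) auto
      then have "exp (?l - \<gamma> * sqrt ?l) \<le> 1" using l0 by simp
      then have "real m * exp (- \<gamma> * sqrt ?l) \<le> 1" by (simp only: em)
      then have "affine_free (int Q) {0} \<and> finite {0::nat} \<and> (\<forall>a\<in>{0}. Q * a < m) \<and>
         real m * exp (- \<gamma> * sqrt ?l) \<le> real (card {0::nat})"
        using m by (auto simp: affine_free_def)
      then show ?thesis by blast
    next
      case False
      define D where "D = E - q"
      have D: "0 < D" "E = D + q" using False by (auto simp: D_def)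
      obtain S where S: "affine_free (int Q) S" "finite S" "2 ^ D\<^sup>2 \<le> card S * 2 ^ (3 * D)"
        "\<And>a. a \<in> S \<Longrightarrow> Q * a < 2 ^ E\<^sup>2"
        using affine_free_power_two[OF Q q D(1)] D(2) by metis
      have "real (2 ^ D\<^sup>2) \<le> real (card S * 2 ^ (3 * D))" using S(3) by (simp only: of_nat_le_iff)
      then have cS: "(2::real) ^ D\<^sup>2 \<le> real (card S) * 2 ^ (3 * D)" by simp
      have c0: "0 < card S" using S(3) by (metis gr0I mult_0 not_less power_eq_0_iff zero_less_numeral zero_neq_numeral le_zero_eq)
      have "ln (2 ^ D\<^sup>2) \<le> ln (real (card S) * 2 ^ (3 * D))" using cS c0 by (subst ln_le_cancel_iff) auto
      then have lnS: "real (D\<^sup>2) * ln 2 \<le> ln (real (card S)) + real (3 * D) * ln 2"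
        using c0 by (simp add: ln_mult ln_realpow)
      have "(real E * ln 2)\<^sup>2 = real (E\<^sup>2) * ln 2 * ln 2" by (simp add: power2_eq_square)
      also have "\<dots> \<le> real (E\<^sup>2) * ln 2" using ln2 by (simp add: mult_left_le)
      also note lo
      finally have "real E * ln 2 \<le> sqrt (ln (real m))" by (rule real_le_rsqrt)
      then have "\<gamma> * (real E * ln 2) \<le> \<gamma> * sqrt (ln (real m))" by (intro mult_left_mono) (auto simp: \<gamma>_def)
      then have "ln (real m) - \<gamma> * sqrt (ln (real m)) \<le> (real ((E + 1)\<^sup>2) - \<gamma> * real E) * ln 2"
        using hi by (simp add: algebra_simps)
      also have "\<dots> \<le> (real (D\<^sup>2) - real (3 * D)) * ln 2"
      proof (intro mult_right_mono)
        have "1 \<le> real D" "0 \<le> real q * real q" using D by auto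
        then have "0 \<le> (real D - 1) + real q * real q + 4 * real q" by simp
        then show "real ((E + 1)\<^sup>2) - \<gamma> * real E \<le> real (D\<^sup>2) - real (3 * D)"
          by (simp add: D(2) \<gamma>_def power2_eq_square algebra_simps)
      qed (use ln2 in auto)
      also have "\<dots> \<le> ln (real (card S))" using lnS by (simp add: algebra_simps)
      finally have "exp (ln (real m) - \<gamma> * sqrt (ln (real m))) \<le> real (card S)"
        using c0 by (metis exp_le_cancel_iff exp_ln of_nat_0_less_iff)
      then show ?thesis using S E em by (metis less_le_trans)
    qed
  qed
  then show thesis using that[of \<gamma>] by (simp add: \<gamma>_def)
qed

section \<open>The family of lines\<close>

text \<open>
  Residue \<open>y\<close> in copy \<open>k\<close>; the successor makes \<open>{1..r * m}\<close> the set of all vertices.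
\<close>

definition vertex :: "nat \<Rightarrow> nat \<Rightarrow> nat \<Rightarrow> nat" where
  "vertex m k y = Suc (k * m + y)"

definition edge :: "nat \<Rightarrow> nat \<Rightarrow> (nat \<Rightarrow> nat) \<Rightarrow> nat \<Rightarrow> nat \<Rightarrow> nat set" where
  "edge m r c x a = (\<lambda>k. vertex m k ((x + c k * a) mod m)) ` {..<r}"

lemma vertex_eq_iff:
  assumes "y < m" "y' < m"
  shows "vertex m k y = vertex m k' y' \<longleftrightarrow> k = k' \<and> y = y'"
proof
  assume "vertex m k y = vertex m k' y'"
  then have e: "k * m + y = k' * m + y'" by (simp add: vertex_def)
  then have "(k * m + y) div m = (k' * m + y') div m" "(k * m + y) mod m = (k' * m + y') mod m" by simp_all
  then show "k = k' \<and> y = y'" using assms by simp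
qed simp

lemma coef_le: "0 < p \<Longrightarrow> k < r \<Longrightarrow> coef p r k \<le> p * r"
proof -
  assume "0 < p" "k < r"
  have "coef p r k \<le> p * (k + 1)" using \<open>0 < p\<close> mult_le_mono1[of 1 p "k + 1"] by (simp add: coef_def)
  also have "\<dots> \<le> p * r" using \<open>k < r\<close> by (intro mult_le_mono2) simp
  finally show ?thesis .
qed

lemma inj_on_coef:
  assumes "r < p" shows "inj_on (coef p r) {..<r}"
proof -
  have "p * (k + 1) \<noteq> l + 1" if "l < r" for k l
    using that assms by (metis Suc_eq_plus1 dvd_imp_le dvd_triv_left le_trans not_less Suc_leI zero_less_Suc)
  moreover have "0 < p" using assms by simp
  ultimately show ?thesis by (auto simp: inj_on_def coef_def) metis+
qed

text \<open>
  The coefficients are at most \<open>p r\<close>. The factor \<open>4\<close> makes sums of four products of a coefficient and a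
  difference of slopes smaller than \<open>m\<close>; the elimination of the starts of a grid needs four.
\<close>

locale line_family =
  fixes m r p :: nat and S :: "nat set"
  assumes m: "0 < m" and r: "4 \<le> r" and p: "prime p" "r < p"
    and S: "finite S" "affine_free (int (4 * (p * r))) S" "\<And>a. a \<in> S \<Longrightarrow> 4 * (p * r) * a < m"
begin

abbreviation c :: "nat \<Rightarrow> nat" where "c \<equiv> coef p r"
abbreviation E :: "nat \<Rightarrow> nat \<Rightarrow> nat set" where "E \<equiv> edge m r c"

definition F :: "nat set set" where "F = (\<lambda>(x, a). E x a) ` ({..<m} \<times> S)"

lemma mem_edge_iff:
  "y < m \<Longrightarrow> vertex m k y \<in> E x a \<longleftrightarrow> k < r \<and> y = (x + c k * a) mod m"
  using m by (auto simp: edge_def vertex_eq_iff)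

text \<open>
  A common vertex determines its copy \<open>k\<close> of the residues, and gives one congruence.
\<close>

lemma meet:
  assumes "v \<in> E x a" "v \<in> E y b"
  obtains k where "k < r" "v = vertex m k ((x + c k * a) mod m)" "v = vertex m k ((y + c k * b) mod m)"
    "int m dvd int x - int y + int (c k) * (int a - int b)"
proof -
  obtain k where k: "k < r" "v = vertex m k ((x + c k * a) mod m)" using assms(1) by (auto simp: edge_def)
  obtain l where l: "l < r" "v = vertex m l ((y + c l * b) mod m)" using assms(2) by (auto simp: edge_def)
  have kl: "k = l" and eq: "(x + c k * a) mod m = (y + c k * b) mod m"
    using k l m by (auto simp: vertex_eq_iff)
  have "int (x + c k * a) mod int m = int (y + c k * b) mod int m"
    using eq by (simp only: zmod_int[symmetric])
  then have "int m dvd int (x + c k * a) - int (y + c k * b)" by (simp only: mod_eq_dvd_iff)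
  also have "int (x + c k * a) - int (y + c k * b) = int x - int y + int (c k) * (int a - int b)"
    by (simp add: algebra_simps)
  finally show thesis using that k l kl by blast
qed

lemma start_eq:
  assumes "x < m" "y < m" "int m dvd int x - int y" shows "x = y"
  using assms zdvd_imp_le[of "int m" "int x - int y"] zdvd_imp_le[of "int m" "int y - int x"]
  by (cases "x < y"; cases "y < x") (auto simp: dvd_diff_commute)

lemma same_slope_meet:
  assumes "x < m" "y < m" "v \<in> E x a" "v \<in> E y a" shows "x = y"
  using meet[OF assms(3,4)] start_eq[OF assms(1,2)] by (metis add.right_neutral diff_self mult_zero_right)

lemma small:
  assumes "a \<in> S" "\<bar>e\<bar> \<le> int (p * r)" shows "4 * \<bar>e * int a\<bar> < int m"
proof -
  have "4 * \<bar>e * int a\<bar> = 4 * (\<bar>e\<bar> * int a)" by (simp add: abs_mult)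
  also have "\<dots> \<le> 4 * (int (p * r) * int a)" using assms by (intro mult_left_mono mult_right_mono) auto
  also have "\<dots> = int (4 * (p * r) * a)" by simp
  also have "\<dots> < int m" using S(3)[OF assms(1)] by (simp only: of_nat_less_iff)
  finally show ?thesis .
qed

lemma small_diff:
  assumes "a \<in> S" "b \<in> S" "\<bar>e\<bar> \<le> int (p * r)" shows "4 * \<bar>e * (int a - int b)\<bar> < int m"
proof (cases "a \<le> b")
  case True
  then have "\<bar>e * (int a - int b)\<bar> \<le> \<bar>e * int b\<bar>" by (simp add: abs_mult mult_left_mono)
  then show ?thesis using small[OF assms(2,3)] by linarith
next
  case False
  then have "\<bar>e * (int a - int b)\<bar> \<le> \<bar>e * int a\<bar>" by (simp add: abs_mult mult_left_mono)
  then show ?thesis using small[OF assms(1,3)] by linarith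
qed

lemma coef_bound: "k < r \<Longrightarrow> int (c k) \<le> int (p * r)"
  using coef_le[of p k r] p by (simp only: of_nat_le_iff)

lemma coef_diff_bound: "k < r \<Longrightarrow> l < r \<Longrightarrow> \<bar>int (c k) - int (c l)\<bar> \<le> int (p * r)"
  using coef_bound[of k] coef_bound[of l] by linarith

lemma coef_neq: "k < r \<Longrightarrow> l < r \<Longrightarrow> k \<noteq> l \<Longrightarrow> c k \<noteq> c l"
  using inj_on_coef[OF p(2)] by (auto simp: inj_on_def)

lemma multiple_zero: "int m dvd d \<Longrightarrow> \<bar>d\<bar> < int m \<Longrightarrow> d = 0"
  using dvd_imp_le_int[of d "int m"] m by linarith

text \<open>
  Subtracting the congruences of two common vertices eliminates the starts.
\<close>

lemma two_common_points:
  assumes xy: "x < m" "y < m" and ab: "a \<in> S" "b \<in> S"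
    and v: "v \<in> E x a" "v \<in> E y b" and w: "w \<in> E x a" "w \<in> E y b" and "v \<noteq> w"
  shows "x = y \<and> a = b"
proof -
  obtain k where k: "k < r" "v = vertex m k ((x + c k * a) mod m)"
    "int m dvd int x - int y + int (c k) * (int a - int b)" using meet[OF v] by metis
  obtain l where l: "l < r" "w = vertex m l ((x + c l * a) mod m)"
    "int m dvd int x - int y + int (c l) * (int a - int b)" using meet[OF w] by metis
  have kl: "k \<noteq> l" using k l \<open>v \<noteq> w\<close> by auto
  have "int m dvd (int (c k) - int (c l)) * (int a - int b)"
    using dvd_diff[OF k(3) l(3)] by (simp add: algebra_simps)
  then have "(int (c k) - int (c l)) * (int a - int b) = 0"
    using small_diff[OF ab coef_diff_bound[OF k(1) l(1)]] by (intro multiple_zero) auto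
  then have "a = b" using coef_neq[OF k(1) l(1) kl] by auto
  then show ?thesis using same_slope_meet xy v by auto
qed

lemma edge_card: "card (E x a) = r"
proof -
  have "inj_on (\<lambda>k. vertex m k ((x + c k * a) mod m)) {..<r}" using m by (auto simp: inj_on_def vertex_eq_iff)
  then show ?thesis by (simp add: edge_def card_image)
qed

lemma edge_finite: "finite (E x a)" by (simp add: edge_def)

lemma inj_on_edge: "inj_on (\<lambda>(x, a). E x a) ({..<m} \<times> S)"
proof -
  have "x = y \<and> a = b" if "x < m" "y < m" "a \<in> S" "b \<in> S" "E x a = E y b" for x y a b
  proof -
    have "\<not> card (E x a) \<le> Suc 0" using r by (simp add: edge_card)
    then obtain v w where "v \<in> E x a" "w \<in> E x a" "v \<noteq> w"
      using card_le_Suc0_iff_eq[OF edge_finite] by blast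
    then show ?thesis using two_common_points[of x y a b v w] that by auto
  qed
  then show ?thesis by (auto simp: inj_on_def)
qed

lemma card_F: "card F = m * card S"
  by (simp add: F_def card_image[OF inj_on_edge] card_cartesian_product)

lemma uniform_F: "uniform r {1..r * m} F"
proof -
  have "vertex m k y \<in> {1..r * m}" if "k < r" "y < m" for k y
  proof -
    have "k * m + y < Suc k * m" using that by simp
    also have "\<dots> \<le> r * m" using that by (intro mult_le_mono1) simp
    finally show ?thesis by (simp add: vertex_def)
  qed
  then have "E x a \<subseteq> {1..r * m}" for x a using m by (auto simp: edge_def)
  then show ?thesis by (auto simp: uniform_def F_def edge_card)
qed

lemma linear_F:
  assumes "A \<in> F" "B \<in> F" "A \<noteq> B" shows "card (A \<inter> B) \<le> 1"
proof -
  obtain x a y b where *: "A = E x a" "B = E y b" "x < m" "y < m" "a \<in> S" "b \<in> S"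
    using assms by (auto simp: F_def)
  have "v = w" if "v \<in> A \<inter> B" "w \<in> A \<inter> B" for v w
    using two_common_points[of x y a b v w] * assms(3) that by auto
  then show ?thesis using card_le_Suc0_iff_eq[of "A \<inter> B"] edge_finite * by auto
qed

text \<open>
  The three meeting points lie in different copies, since otherwise two of them would coincide.
  Adding the three congruences cancels the starts and leaves a relation between the slopes with
  coefficients \<open>c i - c k\<close>, \<open>c j - c i\<close>, \<open>c k - c j\<close>.
\<close>

lemma triangle_free_F:
  assumes F: "A1 \<in> F" "A2 \<in> F" "A3 \<in> F" and ne: "A1 \<noteq> A2"
    and meets: "A1 \<inter> A2 \<noteq> {}" "A1 \<inter> A3 \<noteq> {}" "A2 \<inter> A3 \<noteq> {}"
  shows "A1 \<inter> A2 \<inter> A3 \<noteq> {}"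
proof
  assume empty: "A1 \<inter> A2 \<inter> A3 = {}"
  obtain x1 a1 x2 a2 x3 a3 where A: "A1 = E x1 a1" "A2 = E x2 a2" "A3 = E x3 a3"
    and x: "x1 < m" "x2 < m" "x3 < m" and a: "a1 \<in> S" "a2 \<in> S" "a3 \<in> S"
    using F by (auto simp: F_def)
  obtain u v w where uvw: "u \<in> E x1 a1" "u \<in> E x2 a2" "v \<in> E x2 a2" "v \<in> E x3 a3" "w \<in> E x3 a3" "w \<in> E x1 a1"
    using meets unfolding A by blast
  obtain i where i: "i < r" "u = vertex m i ((x1 + c i * a1) mod m)" "u = vertex m i ((x2 + c i * a2) mod m)"
    "int m dvd int x1 - int x2 + int (c i) * (int a1 - int a2)" using meet[OF uvw(1,2)] by metis
  obtain j where j: "j < r" "v = vertex m j ((x2 + c j * a2) mod m)" "v = vertex m j ((x3 + c j * a3) mod m)"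
    "int m dvd int x2 - int x3 + int (c j) * (int a2 - int a3)" using meet[OF uvw(3,4)] by metis
  obtain k where k: "k < r" "w = vertex m k ((x3 + c k * a3) mod m)" "w = vertex m k ((x1 + c k * a1) mod m)"
    "int m dvd int x3 - int x1 + int (c k) * (int a3 - int a1)" using meet[OF uvw(5,6)] by metis
  have "i \<noteq> j" using i(3) j(2) uvw(1,2,4) empty A by blast
  have "j \<noteq> k" using j(3) k(2) uvw(3,4,6) empty A by blast
  have "k \<noteq> i" using k(3) i(2) uvw(2,5,6) empty A by blast
  let ?\<alpha> = "int (c i) - int (c k)" and ?\<beta> = "int (c j) - int (c i)" and ?\<gamma> = "int (c k) - int (c j)"
  have bd: "\<bar>?\<alpha>\<bar> \<le> int (p * r)" "\<bar>?\<beta>\<bar> \<le> int (p * r)" "\<bar>?\<gamma>\<bar> \<le> int (p * r)"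
    using coef_diff_bound i(1) j(1) k(1) by auto
  have "int m dvd (int x1 - int x2 + int (c i) * (int a1 - int a2)) +
      (int x2 - int x3 + int (c j) * (int a2 - int a3)) + (int x3 - int x1 + int (c k) * (int a3 - int a1))"
    by (rule dvd_add[OF dvd_add[OF i(4) j(4)] k(4)])
  also have "\<dots> = ?\<alpha> * int a1 + ?\<beta> * int a2 + ?\<gamma> * int a3" by (simp add: algebra_simps)
  finally have rel: "?\<alpha> * int a1 + ?\<beta> * int a2 + ?\<gamma> * int a3 = 0"
    using small[OF a(1) bd(1)] small[OF a(2) bd(2)] small[OF a(3) bd(3)]
    by (intro multiple_zero) linarith+
  have "?\<alpha> \<noteq> 0" "?\<beta> \<noteq> 0" "?\<gamma> \<noteq> 0"
    using coef_neq i(1) j(1) k(1) \<open>i \<noteq> j\<close> \<open>j \<noteq> k\<close> \<open>k \<noteq> i\<close> by auto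
  moreover have "\<bar>?\<alpha>\<bar> \<le> int (4 * (p * r))" "\<bar>?\<beta>\<bar> \<le> int (4 * (p * r))" "\<bar>?\<gamma>\<bar> \<le> int (4 * (p * r))"
    using bd by linarith+
  ultimately have "a1 = a2"
    using S(2)[unfolded affine_free_def, rule_format, of a1 a2 a3 ?\<alpha> ?\<beta> ?\<gamma>] a rel by simp
  then have "x1 = x2" using same_slope_meet[OF x(1,2)] uvw by blast
  then show False using ne A \<open>a1 = a2\<close> by blast
qed

text \<open>
  The starts satisfy their equations only modulo \<open>m\<close>. In the combination belonging to two rows and two
  columns they cancel, and the remaining relation between slopes is small enough to
  hold over the integers. Hence \<open>u X Y = c (L X Y) (b Y - a X)\<close> is a difference of a row function and a
  column function, which serve as new integer starts.
\<close>

lemma grid_free_F: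
  assumes sub: "\<A> \<subseteq> F" "\<B> \<subseteq> F" shows "\<not> grid r \<A> \<B>"
proof
  assume G: "grid r \<A> \<B>"
  have "\<forall>X\<in>F. \<exists>x a. x < m \<and> a \<in> S \<and> X = E x a" by (auto simp: F_def)
  then obtain st sl where st: "\<And>X. X \<in> F \<Longrightarrow> st X < m" and sl: "\<And>X. X \<in> F \<Longrightarrow> sl X \<in> S"
    and E: "\<And>X. X \<in> F \<Longrightarrow> X = E (st X) (sl X)" by metis
  define pt where "pt X k = vertex m k ((st X + c k * sl X) mod m)" for X k
  define meets_in where "meets_in X Y k \<longleftrightarrow> k < r \<and> pt X k \<in> X \<inter> Y \<and> pt X k = pt Y k \<and>
      int m dvd int (st X) - int (st Y) + int (c k) * (int (sl X) - int (sl Y))" for X Y k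
  define L where "L X Y = (SOME k. meets_in X Y k)" for X Y
  have "\<exists>k. meets_in X Y k" if "X \<in> \<A>" "Y \<in> \<B>" for X Y
  proof -
    have XY: "X \<in> F" "Y \<in> F" using that sub by auto
    have "X \<inter> Y \<noteq> {}" using G that by (simp add: grid_def)
    then obtain v where v: "v \<in> X" "v \<in> Y" by blast
    then have "v \<in> E (st X) (sl X)" "v \<in> E (st Y) (sl Y)" using E[OF XY(1)] E[OF XY(2)] by auto
    then obtain k where "k < r" "v = pt X k" "v = pt Y k"
      "int m dvd int (st X) - int (st Y) + int (c k) * (int (sl X) - int (sl Y))"
      unfolding pt_def by (rule meet)
    then show ?thesis using v by (intro exI[of _ k]) (auto simp: meets_in_def)
  qed
  then have L_at: "meets_in X Y (L X Y)" if "X \<in> \<A>" "Y \<in> \<B>" for X Y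
    unfolding L_def using that by (intro someI_ex[of "meets_in X Y"])
  have L: "\<And>X Y. X \<in> \<A> \<Longrightarrow> Y \<in> \<B> \<Longrightarrow> L X Y < r"
    and pt: "\<And>X Y. X \<in> \<A> \<Longrightarrow> Y \<in> \<B> \<Longrightarrow> pt X (L X Y) \<in> X \<inter> Y" "\<And>X Y. X \<in> \<A> \<Longrightarrow> Y \<in> \<B> \<Longrightarrow> pt X (L X Y) = pt Y (L X Y)"
    and dv: "\<And>X Y. X \<in> \<A> \<Longrightarrow> Y \<in> \<B> \<Longrightarrow>
      int m dvd int (st X) - int (st Y) + int (c (L X Y)) * (int (sl X) - int (sl Y))"
    using L_at by (auto simp: meets_in_def)
  have g: "card \<A> = r" "card \<B> = r" "\<A> \<inter> \<B> = {}" "disjoint \<A>" "disjoint \<B>"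
    using G by (auto simp: grid_def)
  have fin: "finite \<A>" "finite \<B>" using g r by (auto intro: card_ge_0_finite)
  have "bij_betw (L X) \<B> {..<r}" if X: "X \<in> \<A>" for X
  proof -
    have inj: "inj_on (L X) \<B>"
    proof (rule inj_onI)
      fix Y Y' assume Y: "Y \<in> \<B>" "Y' \<in> \<B>" and "L X Y = L X Y'"
      then have "Y \<inter> Y' \<noteq> {}" using pt(1)[OF X Y(1)] pt(1)[OF X Y(2)] by auto
      then show "Y = Y'" using disjointD[OF g(5) Y] by blast
    qed
    moreover have "L X ` \<B> = {..<r}"
      using L X card_image[OF inj] g by (intro card_subset_eq) auto
    ultimately show ?thesis by (simp add: bij_betw_def)
  qed
  moreover have "bij_betw (\<lambda>X. L X Y) \<A> {..<r}" if Y: "Y \<in> \<B>" for Y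
  proof -
    have inj: "inj_on (\<lambda>X. L X Y) \<A>"
    proof (rule inj_onI)
      fix X X' assume X: "X \<in> \<A>" "X' \<in> \<A>" and "L X Y = L X' Y"
      then have "pt X (L X Y) = pt X' (L X' Y)" using pt(2)[OF X(1) Y] pt(2)[OF X(2) Y] by simp
      then have "X \<inter> X' \<noteq> {}" using pt(1)[OF X(1) Y] pt(1)[OF X(2) Y] by auto
      then show "X = X'" using disjointD[OF g(4) X] by blast
    qed
    moreover have "(\<lambda>X. L X Y) ` \<A> = {..<r}"
      using L Y card_image[OF inj] g by (intro card_subset_eq) auto
    ultimately show ?thesis by (simp add: bij_betw_def)
  qed
  ultimately have latin: "latin r \<A> \<B> L" using fin by (simp add: latin_def)
  define u where "u X Y = int (c (L X Y)) * (int (sl Y) - int (sl X))" for X Y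
  have um: "int m dvd int (st X) - int (st Y) - u X Y" if "X \<in> \<A>" "Y \<in> \<B>" for X Y
    using dv[OF that] by (simp add: u_def algebra_simps)
  have ub: "4 * \<bar>u X Y\<bar> < int m" if "X \<in> \<A>" "Y \<in> \<B>" for X Y
    unfolding u_def using that sub coef_bound[OF L[OF that]] by (intro small_diff sl) auto
  have additive: "u X Y - u X Y' - u X' Y + u X' Y' = 0" if "X \<in> \<A>" "X' \<in> \<A>" "Y \<in> \<B>" "Y' \<in> \<B>" for X X' Y Y'
  proof (rule multiple_zero)
    have "int m dvd ((int (st X) - int (st Y') - u X Y') - (int (st X) - int (st Y) - u X Y)) -
        ((int (st X') - int (st Y') - u X' Y') - (int (st X') - int (st Y) - u X' Y))"
      using that by (intro dvd_diff um)
    then show "int m dvd u X Y - u X Y' - u X' Y + u X' Y'" by (simp add: algebra_simps)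
    show "\<bar>u X Y - u X Y' - u X' Y + u X' Y'\<bar> < int m"
      using ub[OF that(1,3)] ub[OF that(1,4)] ub[OF that(2,3)] ub[OF that(2,4)] by linarith
  qed
  obtain X0 where X0: "X0 \<in> \<A>" using g r by (metis card.empty ex_in_conv not_numeral_le_zero)
  obtain Y0 where Y0: "Y0 \<in> \<B>" using g r by (metis card.empty ex_in_conv not_numeral_le_zero)
  have "grid_solution c \<A> \<B> L (\<lambda>X. u X Y0) (\<lambda>Y. u X0 Y0 - u X0 Y) (\<lambda>X. int (sl X)) (\<lambda>Y. int (sl Y))"
    unfolding grid_solution_def
  proof (intro ballI)
    fix X Y assume XY: "X \<in> \<A>" "Y \<in> \<B>"
    have "u X Y0 - (u X0 Y0 - u X0 Y) = u X Y" using additive[OF XY(1) X0 XY(2) Y0] by linarith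
    also have "\<dots> = int (c (L X Y)) * int (sl Y) - int (c (L X Y)) * int (sl X)"
      by (simp add: u_def right_diff_distrib)
    finally show "u X Y0 + int (c (L X Y)) * int (sl X) = u X0 Y0 - u X0 Y + int (c (L X Y)) * int (sl Y)"
      by linarith
  qed
  from grid_solution_trivial[OF latin r p this X0 Y0] have sl_eq: "sl X0 = sl Y0" by simp
  have XY: "X0 \<in> F" "Y0 \<in> F" using X0 Y0 sub by auto
  have "pt X0 (L X0 Y0) \<in> E (st X0) (sl X0)" "pt X0 (L X0 Y0) \<in> E (st Y0) (sl X0)"
    using pt(1)[OF X0 Y0] E[OF XY(1)] E[OF XY(2)] sl_eq by auto
  then have "st X0 = st Y0" using same_slope_meet st XY by blast
  then have "X0 = Y0" using E[OF XY(1)] E[OF XY(2)] sl_eq by simp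
  then show False using X0 Y0 g(3) by blast
qed

lemma union_free_F: "union_free r F"
  using r uniform_F linear_F triangle_free_F grid_free_F
  by (intro union_free_if_no_triangle_no_grid[of r "{1..r * m}"]) auto

text \<open>
  Through a given vertex there is exactly one line of each slope.
\<close>

lemma decomposes_F: "decomposes_into_perfect_matchings {1..r * m} F"
proof -
  define M where "M a = (\<lambda>x. E x a) ` {..<m}" for a
  have eq: "x = y \<and> a = b" if "x < m" "y < m" "a \<in> S" "b \<in> S" "E x a = E y b" for x y a b
    using inj_on_edge that by (auto simp: inj_on_def)
  have "partition_on F (M ` S)"
  proof (rule partition_onI)
    show "\<Union>(M ` S) = F" by (auto simp: M_def F_def)
    show "disjnt M1 M2" if M12: "M1 \<in> M ` S" "M2 \<in> M ` S" "M1 \<noteq> M2" for M1 M2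
    proof (rule ccontr)
      assume "\<not> disjnt M1 M2"
      then have "M1 \<inter> M2 \<noteq> {}" by (simp add: disjnt_def)
      moreover obtain a b where ab: "a \<in> S" "b \<in> S" "M1 = M a" "M2 = M b" using M12 by blast
      ultimately obtain x y where "x < m" "y < m" "E x a = E y b" by (auto simp: M_def)
      then have "a = b" using eq ab by blast
      then show False using ab M12 by blast
    qed
    show "{} \<notin> M ` S" using m by (auto simp: M_def)
  qed
  moreover have "perfect_matching {1..r * m} F (M a)" if a: "a \<in> S" for a
    unfolding perfect_matching_def
  proof (intro conjI ballI)
    show "M a \<subseteq> F" using a by (auto simp: M_def F_def)
    fix v assume "v \<in> {1..r * m}"
    then have v: "1 \<le> v" "v - 1 < r * m" by auto
    define k y where "k = (v - 1) div m" and "y = (v - 1) mod m"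
    have k: "k < r" using v m by (simp add: k_def less_mult_imp_div_less)
    have y: "y < m" using m by (simp add: y_def)
    have vk: "v = vertex m k y" using v by (simp add: vertex_def k_def y_def)
    \<comment> \<open>The line of slope \<open>a\<close> through \<open>v\<close>, followed back from copy \<open>k\<close> to its start.\<close>
    define x where "x = nat ((int y - int (c k * a)) mod int m)"
    have x: "int x = (int y - int (c k * a)) mod int m" using m by (simp add: x_def)
    then have "int x < int m" using m by simp
    then have xm: "x < m" by simp
    have "int ((x + c k * a) mod m) = int y"
      using x y by (simp add: zmod_int mod_simps)
    then have "v \<in> E x a" unfolding vk using mem_edge_iff[OF y] k by simp
    then show "\<exists>!A. A \<in> M a \<and> v \<in> A"
      using xm same_slope_meet by (intro ex1I[of _ "E x a"]) (auto simp: M_def)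
  qed
  ultimately show ?thesis unfolding decomposes_into_perfect_matchings_def by blast
qed

end

lemma dense_union_free_decomposable:
  assumes r: "4 \<le> r"
  obtains \<gamma> :: real where "0 < \<gamma>"
    "\<And>m. 0 < m \<Longrightarrow> \<exists>F. uniform r {1..r * m} F \<and> union_free r F \<and>
       decomposes_into_perfect_matchings {1..r * m} F \<and>
       (real m)\<^sup>2 * exp (- \<gamma> * sqrt (ln (real m))) \<le> real (card F)"
proof -
  obtain p where p: "prime p" "r < p" using bigger_prime by blast
  have "0 < 4 * (p * r)" using p r by simp
  from behrend[OF this] obtain \<gamma> :: real where \<gamma>: "0 < \<gamma>"
    "\<And>m. 0 < m \<Longrightarrow> \<exists>S. affine_free (int (4 * (p * r))) S \<and> finite S \<and> (\<forall>a\<in>S. 4 * (p * r) * a < m) \<and>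
       real m * exp (- \<gamma> * sqrt (ln (real m))) \<le> real (card S)" by blast
  show thesis
  proof (rule that[OF \<gamma>(1)])
    fix m :: nat assume m: "0 < m"
    obtain S where S_props: "affine_free (int (4 * (p * r))) S" "finite S" "\<And>a. a \<in> S \<Longrightarrow> 4 * (p * r) * a < m"
      "real m * exp (- \<gamma> * sqrt (ln (real m))) \<le> real (card S)" using \<gamma>(2)[OF m] by blast
    interpret line_family m r p S using m r p S_props by unfold_locales auto
    have "real m * (real m * exp (- \<gamma> * sqrt (ln (real m)))) \<le> real m * real (card S)"
      using S_props(4) by (intro mult_left_mono) auto
    then have "(real m)\<^sup>2 * exp (- \<gamma> * sqrt (ln (real m))) \<le> real (card F)"
      by (simp add: card_F power2_eq_square mult.assoc)
    then show "\<exists>F. uniform r {1..r * m} F \<and> union_free r F \<and>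
       decomposes_into_perfect_matchings {1..r * m} F \<and>
       (real m)\<^sup>2 * exp (- \<gamma> * sqrt (ln (real m))) \<le> real (card F)"
      using uniform_F union_free_F decomposes_F by blast
  qed
qed

section \<open>Regularity and the choice of the constant\<close>

text \<open>
  Each matching of the decomposition contains exactly one edge through \<open>v\<close>, so all degrees equal the
  number of matchings.
\<close>

lemma regular_if_decomposes:
  assumes "decomposes_into_perfect_matchings V F"
  shows "regular V F"
proof -
  obtain P where P: "partition_on F P" "\<And>M. M \<in> P \<Longrightarrow> perfect_matching V F M"
    using assms by (auto simp: decomposes_into_perfect_matchings_def)
  have "card {A \<in> F. v \<in> A} = card P" if v: "v \<in> V" for v
  proof -
    define e where "e M = (THE A. A \<in> M \<and> v \<in> A)" for M
    have ex1: "\<exists>!A. A \<in> M \<and> v \<in> A" if "M \<in> P" for M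
      using P(2)[OF that] v by (simp add: perfect_matching_def)
    have e: "e M \<in> M" "v \<in> e M" if "M \<in> P" for M
      using theI'[OF ex1[OF that]] by (auto simp: e_def)
    have e_eq: "e M = A" if "M \<in> P" "A \<in> M" "v \<in> A" for M A
      using ex1[OF that(1)] e[OF that(1)] that by blast
    have "inj_on e P"
      using e P(1) by (metis disjointD disjoint_iff inj_onI partition_onD2)
    moreover have "e ` P = {A \<in> F. v \<in> A}"
      using e e_eq partition_onD1[OF P(1)] by (auto simp: image_iff) metis
    ultimately show ?thesis by (metis card_image)
  qed
  then show ?thesis by (auto simp: regular_def)
qed

text \<open>
  Passing from \<open>m\<close> to \<open>n < 2 r m\<close> costs the factor \<open>(2 r)\<^sup>2\<close>. Since \<open>sqrt (ln n) \<ge> 1\<close>, it is absorbed by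
  enlarging the constant in the exponent by \<open>2 ln (2 r)\<close>.
\<close>

lemma lower_bound_transfer:
  fixes n m r :: nat and \<gamma> :: real
  assumes r: "4 \<le> r" and n: "r \<le> n" and m: "0 < m" "m \<le> n" "n < 2 * r * m" and \<gamma>: "0 < \<gamma>"
  shows "(real n)\<^sup>2 * exp (- (\<gamma> + 2 * ln (2 * real r)) * sqrt (ln (real n)))
    < (real m)\<^sup>2 * exp (- \<gamma> * sqrt (ln (real m)))"
proof -
  have "exp 1 \<le> real n" using exp_le r n by linarith
  then have "1 \<le> ln (real n)" using r n by (subst ln_ge_iff) auto
  then have s1: "1 \<le> sqrt (ln (real n))" by simp
  have "sqrt (ln (real m)) \<le> sqrt (ln (real n))" using m by simp
  then have "\<gamma> * sqrt (ln (real m)) \<le> \<gamma> * sqrt (ln (real n))" using \<gamma> by (intro mult_left_mono) auto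
  moreover have "2 * ln (2 * real r) * 1 \<le> 2 * ln (2 * real r) * sqrt (ln (real n))"
    using s1 r by (intro mult_left_mono) auto
  ultimately have "exp (- (\<gamma> + 2 * ln (2 * real r)) * sqrt (ln (real n)))
      \<le> exp (- \<gamma> * sqrt (ln (real m)) - 2 * ln (2 * real r))"
    by (simp add: algebra_simps)
  also have "\<dots> = exp (- \<gamma> * sqrt (ln (real m))) / (2 * real r)\<^sup>2"
  proof -
    have "exp (2 * ln (2 * real r)) = (2 * real r)\<^sup>2" using r by (simp add: exp_double)
    then show ?thesis by (simp add: exp_diff)
  qed
  finally have le: "exp (- (\<gamma> + 2 * ln (2 * real r)) * sqrt (ln (real n)))
      \<le> exp (- \<gamma> * sqrt (ln (real m))) / (2 * real r)\<^sup>2" .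
  have "real n < real (2 * r * m)" using m by (simp only: of_nat_less_iff)
  then have "(real n)\<^sup>2 < (2 * real r * real m)\<^sup>2" by (intro power_strict_mono) auto
  then have "(real n)\<^sup>2 * exp (- (\<gamma> + 2 * ln (2 * real r)) * sqrt (ln (real n)))
      < (2 * real r * real m)\<^sup>2 * exp (- (\<gamma> + 2 * ln (2 * real r)) * sqrt (ln (real n)))"
    by (intro mult_strict_right_mono) auto
  also have "\<dots> \<le> (2 * real r * real m)\<^sup>2 * (exp (- \<gamma> * sqrt (ln (real m))) / (2 * real r)\<^sup>2)"
    using le by (intro mult_left_mono) auto
  also have "\<dots> = (real m)\<^sup>2 * exp (- \<gamma> * sqrt (ln (real m)))"
    using r by (simp add: power_mult_distrib)
  finally show ?thesis .
qed

lemma U_attained: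
  obtains F where "uniform r {1..n} F" "union_free e F" "card F = U r n e"
proof -
  have "{} \<in> {F. uniform r {1..n} F \<and> union_free e F}"
    by (auto simp: uniform_def union_free_def)
  then have "card ` {F. uniform r {1..n} F \<and> union_free e F} \<noteq> {}" by blast
  then have "U r n e \<in> card ` {F. uniform r {1..n} F \<and> union_free e F}"
    unfolding U_def by (intro Max_in finite_imageI finite_uniform_union_free)
  then show thesis using that by auto
qed

theorem corollary1p9:
  fixes r :: nat
  assumes "4 \<le> r"
  shows "\<exists>\<beta>::real. \<beta> > 0 \<and> (\<forall>n::nat. r \<le> n \<longrightarrow>
    (real n)\<^sup>2 * exp (- \<beta> * sqrt (ln (real n))) < real (U r n r) \<and>
    (n = r \<or> (r - 1)\<^sup>2 \<le> n \<longrightarrow>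
      real (U r n r) \<le> real n * (real n - 1) / (real r * (real r - 1))) \<and>
    (r dvd n \<longrightarrow> (\<exists>F. uniform r {1..n} F \<and> union_free r F \<and>
      (real n)\<^sup>2 * exp (- \<beta> * sqrt (ln (real n))) < real (card F) \<and>
      decomposes_into_perfect_matchings {1..n} F \<and> regular {1..n} F)))"
proof -
  obtain \<gamma> :: real where \<gamma>: "0 < \<gamma>"
    and dense: "\<And>m. 0 < m \<Longrightarrow> \<exists>F. uniform r {1..r * m} F \<and> union_free r F \<and>
       decomposes_into_perfect_matchings {1..r * m} F \<and>
       (real m)\<^sup>2 * exp (- \<gamma> * sqrt (ln (real m))) \<le> real (card F)"
    using dense_union_free_decomposable[OF assms] by blast
  define \<beta> where "\<beta> = \<gamma> + 2 * ln (2 * real r)"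
  have \<beta>: "0 < \<beta>" using \<gamma> assms by (simp add: \<beta>_def add_pos_nonneg)
  show ?thesis
  proof (intro exI[of _ \<beta>] conjI allI impI)
    show "0 < \<beta>" by (fact \<beta>)
  next
    fix n assume n: "r \<le> n"
    define m where "m = n div r"
    have m: "0 < m" "m \<le> n" using n assms by (auto simp: m_def div_greater_zero_iff)
    have rm: "r * m \<le> n" by (simp add: m_def)
    have "n mod r < r" using assms by simp
    also have "r \<le> r * m" using m by simp
    finally have "n < 2 * r * m" using mult_div_mod_eq[of r n] unfolding m_def[symmetric] by linarith
    note transfer = lower_bound_transfer[OF assms n m this \<gamma>, folded \<beta>_def]
    obtain F where F: "uniform r {1..r * m} F" "union_free r F"
        "decomposes_into_perfect_matchings {1..r * m} F"
      and big: "(real m)\<^sup>2 * exp (- \<gamma> * sqrt (ln (real m))) \<le> real (card F)"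
      using dense[OF m(1)] by blast
    have lower: "(real n)\<^sup>2 * exp (- \<beta> * sqrt (ln (real n))) < real (card F)"
      using transfer big by linarith
    have "uniform r {1..n} F" using F(1) rm unfolding uniform_def by fastforce
    then have "card F \<le> U r n r" using F(2) by (rule card_le_U)
    then show "(real n)\<^sup>2 * exp (- \<beta> * sqrt (ln (real n))) < real (U r n r)"
      using lower by linarith
    show "\<exists>F. uniform r {1..n} F \<and> union_free r F \<and>
        (real n)\<^sup>2 * exp (- \<beta> * sqrt (ln (real n))) < real (card F) \<and>
        decomposes_into_perfect_matchings {1..n} F \<and> regular {1..n} F" if "r dvd n"
    proof -
      have "r * m = n" using that by (simp add: m_def)
      then show ?thesis using F lower regular_if_decomposes by blast
    qed
    show "real (U r n r) \<le> real n * (real n - 1) / (real r * (real r - 1))" if "n = r \<or> (r - 1)\<^sup>2 \<le> n"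
    proof -
      obtain F where F: "uniform r {1..n} F" "union_free r F" "card F = U r n r"
        by (rule U_attained)
      have "U r n r * (r * (r - 1)) \<le> n * (n - 1)"
        using union_free_card_bound[of r "{1..n}" n F] that F assms by simp
      then have "real (U r n r * (r * (r - 1))) \<le> real (n * (n - 1))" by (simp only: of_nat_le_iff)
      then show ?thesis using assms n by (simp add: pos_le_divide_eq of_nat_diff)
    qed
  qed
qed

end
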